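(* Let $T\in(0,+\infty]$ be a final time, let $n\ge 1$ and $\mathbb{S}=\{1,\dots,n\}$. Consider positive encounter rates $\{\eta_{hk}\}_{h,k\in\mathbb{S}}$ and positive transition rates $\{T_{hk}^i\}_{h,k,i\in\mathbb{S}}$ such that $$\sum_{i\in\mathbb{S}}\int_{D_i}T_{hk}^i(x,y,u)\,du=1\qquad\text{for all }(x,y)\in D_h\times D_k\text{ and all }h,k\in\mathbb{S}.$$ Let $f^0=(f_1^0,\dots,f_n^0)$ with $f_i^0\in L^1(D_i)$ and $f_i^0\ge 0$ for every $i\in\mathbb{S}$, and $\sum_{i\in\mathbb{S}}\int_{D_i}f_i^0(u)\,du=1$. Suppose that all encounter rates are bounded, in the sense that for some $C_\eta\in\mathbb{R}^+$ $$\max_{(x,y)\in D_h\times D_k}\eta_{hk}(x,y)<C_\eta\qquad\text{for all }h,k\in\mathbb{S}.$$ Then the system $$\begin{cases}\displaystyle\partial_t f_i(t,u)=\sum_{h,k\in\mathbb{S}}\int_{D_h}\int_{D_k}\eta_{hk}(x,y)\,T_{hk}^i(x,y,u)\,f_h(t,x)\,f_k(t,y)\,dx\,dy-f_i(t,u)\sum_{k\in\mathbb{S}}\int_{D_k}\eta_{ik}(u,x)\,f_k(t,x)\,dx,\\[4pt] f_i(0,u)=f_i^0(u),\end{cases}\qquad i\in\mathbb{S},$$ has a unique solution $f=(f_1,\dots,f_n)\in\mathcal{C}$, where $\mathcal{C}$ is the solution space on $[0,T]$ of functions that are continuously differentiable in time with values in $\mathbf{X}=\{(g_1,\dots,g_n)\mid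 g_i\in L^1(D_i)\ \forall i\in\mathbb{S}\}$.
   Context: For each $i\in\mathbb{S}$, $D_i\subset\mathbb{R}^+$ is an interval of non-negative reals (the microstate domain of subsystem $i$). The encounter rates are (measurable) real functions $\eta_{hk}:D_h\times D_k\to\mathbb{R}$. The transition rates are (measurable) functions $T_{hk}^i:D_h\times D_k\times D_i\to\mathbb{R}$; $T_{hk}^i(x,y,u)$ is the probability density that an agent of subsystem $h$ with microstate $x$ transitions to subsystem $i$ with microstate $u$ after interacting with an agent of subsystem $k$ with microstate $y$. In the double integrals, $x$ ranges over $D_h$ and $y$ over $D_k$. The space $\mathbf{X}$ carries the norm $\sum_{i}\|g_i\|_{L^1(D_i)}$, and $\mathcal{C}=C^1([0,T];\mathbf{X})$, i.e. $f\in\mathcal{C}$ is continuously differentiable in time and $f_i(t,\cdot)\in L^1(D_i)$ for all $t\in[0,T]$ and $i\in\mathbb{S}$. If $T=+\infty$, $[0,T]$ is read as $[0,\infty)$. *)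

theory Defs
  imports "HOL-Analysis.Analysis"
begin

text \<open>
  Elements of \<open>X = L\<^sup>1(D\<^sub>1) \<times> \<dots> \<times> L\<^sup>1(D\<^sub>n)\<close> are handled through representatives
  \<open>g :: nat \<Rightarrow> real \<Rightarrow> real\<close>, of which only the values \<open>g i u\<close> with \<open>i \<in> {1..n}\<close> and \<open>u \<in> D i\<close>
  matter. Equality in \<open>X\<close> is therefore almost everywhere equality, \<open>X_eq\<close>.
\<close>

definition X_space :: "nat \<Rightarrow> (nat \<Rightarrow> real set) \<Rightarrow> (nat \<Rightarrow> real \<Rightarrow> real) set" where
  "X_space n D = {g. \<forall>i\<in>{1..n}. g i absolutely_integrable_on D i}"

definition X_norm :: "nat \<Rightarrow> (nat \<Rightarrow> real set) \<Rightarrow> (nat \<Rightarrow> real \<Rightarrow> real) \<Rightarrow> real" where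
  "X_norm n D g = (\<Sum>i\<in>{1..n}. LINT u:D i|lebesgue. \<bar>g i u\<bar>)"

definition X_eq ::
  "nat \<Rightarrow> (nat \<Rightarrow> real set) \<Rightarrow> (nat \<Rightarrow> real \<Rightarrow> real) \<Rightarrow> (nat \<Rightarrow> real \<Rightarrow> real) \<Rightarrow> bool" where
  "X_eq n D g g' \<longleftrightarrow> (\<forall>i\<in>{1..n}. AE u in lebesgue_on (D i). g i u = g' i u)"

text \<open>
  The Bochner integral of a non-integrable function is \<open>0\<close>, so \<open>X_norm\<close> is only meaningful on
  \<open>X_space\<close>; this is why membership in \<open>X_space\<close> is part of the following two definitions.
\<close>

definition X_continuous_on ::
  "nat \<Rightarrow> (nat \<Rightarrow> real set) \<Rightarrow> real set \<Rightarrow> (real \<Rightarrow> nat \<Rightarrow> real \<Rightarrow> real) \<Rightarrow> bool" where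
  "X_continuous_on n D I f \<longleftrightarrow>
     (\<forall>t\<in>I. f t \<in> X_space n D) \<and>
     (\<forall>t\<in>I. ((\<lambda>s. X_norm n D (\<lambda>i u. f s i u - f t i u)) \<longlongrightarrow> 0) (at t within I))"

definition X_has_derivative_on ::
  "nat \<Rightarrow> (nat \<Rightarrow> real set) \<Rightarrow> real set \<Rightarrow>
   (real \<Rightarrow> nat \<Rightarrow> real \<Rightarrow> real) \<Rightarrow> (real \<Rightarrow> nat \<Rightarrow> real \<Rightarrow> real) \<Rightarrow> bool" where
  "X_has_derivative_on n D I f f' \<longleftrightarrow>
     (\<forall>t\<in>I. f t \<in> X_space n D \<and> f' t \<in> X_space n D) \<and>
     (\<forall>t\<in>I. ((\<lambda>s. X_norm n D (\<lambda>i u. (f s i u - f t i u) / (s - t) - f' t i u)) \<longlongrightarrow> 0)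
               (at t within I))"

definition C1_space ::
  "nat \<Rightarrow> (nat \<Rightarrow> real set) \<Rightarrow> real set \<Rightarrow> (real \<Rightarrow> nat \<Rightarrow> real \<Rightarrow> real) set" where
  "C1_space n D I = {f. \<exists>f'. X_has_derivative_on n D I f f' \<and> X_continuous_on n D I f'}"

text \<open>\<open>[0, T]\<close>, which is \<open>[0, \<infinity>)\<close> when \<open>T = \<infinity>\<close>.\<close>

definition time_interval :: "ereal \<Rightarrow> real set" where
  "time_interval T = {t. 0 \<le> t \<and> ereal t \<le> T}"

text \<open>
  Below, \<open>\<eta> h k x y\<close> is the encounter rate and \<open>\<tau> h k i x y u\<close> the transition rate.
\<close>

definition kinetic_rhs ::
  "nat \<Rightarrow> (nat \<Rightarrow> real set) \<Rightarrow> (nat \<Rightarrow> nat \<Rightarrow> real \<Rightarrow> real \<Rightarrow> real) \<Rightarrow>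
   (nat \<Rightarrow> nat \<Rightarrow> nat \<Rightarrow> real \<Rightarrow> real \<Rightarrow> real \<Rightarrow> real) \<Rightarrow>
   (nat \<Rightarrow> real \<Rightarrow> real) \<Rightarrow> nat \<Rightarrow> real \<Rightarrow> real" where
  "kinetic_rhs n D \<eta> \<tau> g i u =
     (\<Sum>h\<in>{1..n}. \<Sum>k\<in>{1..n}.
        LINT x:D h|lebesgue. LINT y:D k|lebesgue. \<eta> h k x y * \<tau> h k i x y u * g h x * g k y)
     - g i u * (\<Sum>k\<in>{1..n}. LINT x:D k|lebesgue. \<eta> i k u x * g k x)"

text \<open>
  The time derivative is taken in \<open>X\<close>, so the equation holds at every time as an identity
  in \<open>X\<close>, that is, for almost every \<open>u\<close>.
\<close>

definition kinetic_solution ::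
  "nat \<Rightarrow> (nat \<Rightarrow> real set) \<Rightarrow> (nat \<Rightarrow> nat \<Rightarrow> real \<Rightarrow> real \<Rightarrow> real) \<Rightarrow>
   (nat \<Rightarrow> nat \<Rightarrow> nat \<Rightarrow> real \<Rightarrow> real \<Rightarrow> real \<Rightarrow> real) \<Rightarrow>
   (nat \<Rightarrow> real \<Rightarrow> real) \<Rightarrow> real set \<Rightarrow> (real \<Rightarrow> nat \<Rightarrow> real \<Rightarrow> real) \<Rightarrow> bool" where
  "kinetic_solution n D \<eta> \<tau> f0 I f \<longleftrightarrow>
     f \<in> C1_space n D I \<and>
     X_has_derivative_on n D I f (\<lambda>t. kinetic_rhs n D \<eta> \<tau> (f t)) \<and>
     X_eq n D (f 0) f0"

end

theory Submission
  imports Defs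
begin

text \<open>
  The proof rests on an explicit formula for the solution. Write \<open>f\<close> for the whole family of densities, regarded as one
  function on the disjoint union of the domains (\<open>phase_space\<close>), and let \<open>C > 0\<close> bound the encounter rates. Adding and
  subtracting \<open>C * f * (\<integral>f)\<close>, the system reads
    \<open>f' = P (f \<otimes> f) - C * (\<integral>f) * f\<close>,
  where \<open>P\<close> consists of the gain term and of the loss term compensated by the constant rate \<open>C\<close>. Because the rates
  are positive and at most \<open>C\<close>, \<open>P\<close> is a positive linear operator from \<open>L\<^sup>1\<close> of the pairs to \<open>L\<^sup>1\<close>; because the transition
  rates are normalised, it multiplies the total mass by \<open>C\<close>. Both together bound its norm by \<open>C\<close>. Linearity, the norm bound and the mass
  identity are the axioms of the locale \<open>collision_operator\<close>; the locale \<open>interaction_kernel\<close> derives them from the rates.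

  Existence: on densities of mass one the equation is \<open>f' = P (f \<otimes> f) - C * f\<close>, which is solved by the Wild sum
    \<open>f t = (\<Sum>m. exp (- C * t) * (1 - exp (- C * t)) ^ m * W m)\<close>
  with \<open>W 0 = f0\<close> and \<open>W (m + 1) = (\<Sum>j\<le>m. P (W j \<otimes> W (m - j))) / (C * (m + 1))\<close>. By induction, all \<open>W m\<close> have norm at most
  one and mass one. The weights are non-negative with sum one, so the series converges absolutely in \<open>L\<^sup>1\<close> for all
  \<open>t \<ge> 0\<close> and has mass one: the solution is global, without any continuation argument (\<open>wild_sum_solution\<close>). It is
  differentiated term by term, and a Cauchy product identifies the derivative (\<open>P_tensor_wild_sum\<close>). The time derivative is
  continuous because the right hand side is a locally Lipschitz function of \<open>f\<close>.

  Uniqueness: two solutions are bounded on compact time intervals, so the Lipschitz estimate and a Gronwall argument in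
  \<open>L\<^sup>1\<close> show that they agree (\<open>collision_solution_unique\<close>, \<open>L1_Gronwall_zero\<close>).

  The remaining work is measure theoretic. The rates are Lebesgue measurable on product domains, hence the iterated integrals
  of the system are compared almost everywhere with integrals of Borel versions of the rates
  (\<open>AE_collision_rhs_eq_kinetic_rhs\<close>).
\<close>
section \<open>Seminorm and series in \<open>L\<^sup>1\<close>\<close>

definition L1_norm :: "'a measure \<Rightarrow> ('a \<Rightarrow> real) \<Rightarrow> real" where
  "L1_norm M f = (LINT x|M. \<bar>f x\<bar>)"

text \<open>
  The derivative is taken in the \<open>L\<^sup>1\<close> norm, but curves are families of representatives:
  all statements about them are therefore almost everywhere statements, and no quotient space is formed.
\<close>
definition L1_has_derivative_on ::
  "'a measure \<Rightarrow> real set \<Rightarrow> (real \<Rightarrow> 'a \<Rightarrow> real) \<Rightarrow> (real \<Rightarrow> 'a \<Rightarrow> real) \<Rightarrow> bool" where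
  "L1_has_derivative_on M I f f' \<longleftrightarrow>
     (\<forall>t\<in>I. integrable M (f t) \<and> integrable M (f' t)) \<and>
     (\<forall>t\<in>I. ((\<lambda>s. L1_norm M (\<lambda>x. (f s x - f t x) / (s - t) - f' t x)) \<longlongrightarrow> 0) (at t within I))"

lemma L1_norm_nonneg: "0 \<le> L1_norm M f"
  by (simp add: L1_norm_def)

lemma L1_norm_tendsto_zeroI:
  assumes "\<forall>\<^sub>F s in F. L1_norm M (f s) \<le> b s" "(b \<longlongrightarrow> 0) F"
  shows "((\<lambda>s. L1_norm M (f s)) \<longlongrightarrow> 0) F"
  by (rule tendsto_sandwich[OF _ assms(1) tendsto_const assms(2)]) (simp add: L1_norm_nonneg)

lemma
  assumes [measurable]: "\<psi> \<in> borel_measurable M" and bd: "\<And>x. \<bar>\<psi> x\<bar> \<le> 1" and g: "integrable M g"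
  shows integrable_bounded_mult: "integrable M (\<lambda>x. \<psi> x * g x)"
    and abs_integral_bounded_mult_le: "\<bar>LINT x|M. \<psi> x * g x\<bar> \<le> L1_norm M g"
proof -
  show i: "integrable M (\<lambda>x. \<psi> x * g x)"
    by (rule Bochner_Integration.integrable_bound[OF g])
       (use g bd in \<open>auto simp: abs_mult intro!: mult_left_le_one_le\<close>)
  have "\<bar>LINT x|M. \<psi> x * g x\<bar> \<le> (LINT x|M. \<bar>\<psi> x * g x\<bar>)" by (rule integral_abs_bound)
  also have "\<dots> \<le> L1_norm M g"
    unfolding L1_norm_def
  proof (rule integral_mono)
    show "\<bar>\<psi> x * g x\<bar> \<le> \<bar>g x\<bar>" for x
      using bd[of x] by (auto simp: abs_mult intro!: mult_left_le_one_le)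
  qed (use i g in auto)
  finally show "\<bar>LINT x|M. \<psi> x * g x\<bar> \<le> L1_norm M g" .
qed

lemma L1_norm_cong_AE:
  assumes "integrable M f" "integrable M g" "AE x in M. f x = g x"
  shows "L1_norm M f = L1_norm M g"
  unfolding L1_norm_def by (rule integral_cong_AE) (use assms in auto)

lemma L1_norm_triangle:
  assumes "integrable M f" "integrable M g"
  shows "L1_norm M (\<lambda>x. f x + g x) \<le> L1_norm M f + L1_norm M g"
proof -
  have "L1_norm M (\<lambda>x. f x + g x) \<le> (LINT x|M. \<bar>f x\<bar> + \<bar>g x\<bar>)"
    unfolding L1_norm_def by (rule integral_mono) (use assms in auto)
  then show ?thesis using assms by (simp add: L1_norm_def)
qed

lemma L1_norm_scale: "L1_norm M (\<lambda>x. c * f x) = \<bar>c\<bar> * L1_norm M f"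
  by (simp add: L1_norm_def abs_mult)

lemma L1_norm_minus_commute: "L1_norm M (\<lambda>x. f x - g x) = L1_norm M (\<lambda>x. g x - f x)"
  by (simp add: L1_norm_def abs_minus_commute)

lemma L1_norm_triangle_diff:
  assumes "integrable M f" "integrable M g"
  shows "L1_norm M (\<lambda>x. f x - g x) \<le> L1_norm M f + L1_norm M g"
  using L1_norm_triangle[of M f "\<lambda>x. - g x"] assms by (simp add: L1_norm_def)

lemma L1_norm_triangle3:
  assumes "integrable M f" "integrable M g" "integrable M h"
  shows "L1_norm M (\<lambda>x. f x - h x) \<le> L1_norm M (\<lambda>x. f x - g x) + L1_norm M (\<lambda>x. g x - h x)"
  using L1_norm_triangle[of M "\<lambda>x. f x - g x" "\<lambda>x. g x - h x"] assms by simp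

lemma abs_integral_le_L1_norm: "\<bar>LINT x|M. f x\<bar> \<le> L1_norm M f"
  unfolding L1_norm_def by (rule integral_abs_bound)

lemma L1_norm_sum_le:
  assumes "finite A" "\<And>j. j \<in> A \<Longrightarrow> integrable M (f j)"
  shows "L1_norm M (\<lambda>x. \<Sum>j\<in>A. f j x) \<le> (\<Sum>j\<in>A. L1_norm M (f j))"
  using assms
proof (induction rule: finite_induct)
  case (insert a A)
  have "L1_norm M (\<lambda>x. f a x + (\<Sum>j\<in>A. f j x)) \<le> L1_norm M (f a) + L1_norm M (\<lambda>x. \<Sum>j\<in>A. f j x)"
    by (rule L1_norm_triangle) (use insert in auto)
  with insert show ?case by (simp; fastforce)
qed (simp add: L1_norm_def)

lemma AE_eq_if_L1_norm_diff_zero: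
  assumes "integrable M f" "integrable M g" "L1_norm M (\<lambda>x. f x - g x) = 0"
  shows "AE x in M. f x = g x"
proof -
  have "integrable M (\<lambda>x. \<bar>f x - g x\<bar>)" using assms by auto
  from integral_nonneg_eq_0_iff_AE[OF this] assms(3)
  show ?thesis by (simp add: L1_norm_def)
qed

text \<open>
  The series of the absolute values has finite integral by monotone convergence, so it is finite almost
  everywhere. This is what makes an absolutely convergent series in \<open>L\<^sup>1\<close> summable pointwise.
\<close>
lemma AE_summable_if_summable_L1_norm:
  assumes "\<And>m::nat. integrable M (g m)" "summable (\<lambda>m. L1_norm M (g m))"
  shows "AE x in M. summable (\<lambda>m. \<bar>g m x\<bar>)"
proof -
  have [measurable]: "g m \<in> borel_measurable M" for m using assms(1) by auto
  have "(\<integral>\<^sup>+x. (\<Sum>m. ennreal \<bar>g m x\<bar>) \<partial>M) = (\<Sum>m. \<integral>\<^sup>+x. ennreal \<bar>g m x\<bar> \<partial>M)"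
    by (rule nn_integral_suminf) simp
  also have "\<dots> = (\<Sum>m. ennreal (L1_norm M (g m)))"
    unfolding L1_norm_def using assms(1) by (subst nn_integral_eq_integral) auto
  also have "\<dots> \<noteq> top"
    by (rule ennreal_suminf_neq_top[OF assms(2)]) (rule L1_norm_nonneg)
  finally have "AE x in M. (\<Sum>m. ennreal \<bar>g m x\<bar>) \<noteq> \<infinity>"
    by (intro nn_integral_PInf_AE) auto
  then show ?thesis
    by eventually_elim (auto intro: summable_suminf_not_top)
qed

lemma
  assumes int: "\<And>m::nat. integrable M (g m)" and sum: "summable (\<lambda>m. L1_norm M (g m))"
  shows L1_integrable_suminf: "integrable M (\<lambda>x. \<Sum>m. g m x)"
    and L1_integral_sums: "(\<lambda>m. LINT x|M. g m x) sums (LINT x|M. (\<Sum>m. g m x))"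
    and L1_norm_suminf_le: "L1_norm M (\<lambda>x. \<Sum>m. g m x) \<le> (\<Sum>m. L1_norm M (g m))"
proof -
  note ae = AE_summable_if_summable_L1_norm[OF assms]
  show i: "integrable M (\<lambda>x. \<Sum>m. g m x)"
    by (rule integrable_suminf) (use assms ae in \<open>auto simp: L1_norm_def\<close>)
  show "(\<lambda>m. LINT x|M. g m x) sums (LINT x|M. (\<Sum>m. g m x))"
    by (rule sums_integral) (use assms ae in \<open>auto simp: L1_norm_def\<close>)
  have i2: "integrable M (\<lambda>x. \<Sum>m. \<bar>g m x\<bar>)"
    by (rule integrable_suminf) (use assms ae in \<open>auto simp: L1_norm_def\<close>)
  have "(LINT x|M. (\<Sum>m. \<bar>g m x\<bar>)) = (\<Sum>m. L1_norm M (g m))"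
    unfolding L1_norm_def
    by (rule integral_suminf) (use assms ae in \<open>auto simp: L1_norm_def\<close>)
  moreover have "L1_norm M (\<lambda>x. \<Sum>m. g m x) \<le> (LINT x|M. (\<Sum>m. \<bar>g m x\<bar>))"
    unfolding L1_norm_def
  proof (rule integral_mono_AE)
    show "AE x in M. \<bar>\<Sum>m. g m x\<bar> \<le> (\<Sum>m. \<bar>g m x\<bar>)"
      using ae by eventually_elim (rule summable_rabs)
  qed (use i i2 in auto)
  ultimately show "L1_norm M (\<lambda>x. \<Sum>m. g m x) \<le> (\<Sum>m. L1_norm M (g m))" by simp
qed

lemma L1_partial_sums_converge:
  assumes int: "\<And>m::nat. integrable M (g m)" and sum: "summable (\<lambda>m. L1_norm M (g m))"
  shows "(\<lambda>K. L1_norm M (\<lambda>x. (\<Sum>m. g m x) - (\<Sum>m<K. g m x))) \<longlonglongrightarrow> 0"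
proof (rule L1_norm_tendsto_zeroI)
  show "\<forall>\<^sub>F K in sequentially.
      L1_norm M (\<lambda>x. (\<Sum>m. g m x) - (\<Sum>m<K. g m x)) \<le> (\<Sum>m. L1_norm M (g (m + K)))"
  proof (intro always_eventually allI)
    fix K
    have sK: "summable (\<lambda>m. L1_norm M (g (m + K)))"
      using sum by (rule summable_ignore_initial_segment)
    have ae: "AE x in M. (\<Sum>m. g m x) - (\<Sum>m<K. g m x) = (\<Sum>m. g (m + K) x)"
      using AE_summable_if_summable_L1_norm[OF assms]
    proof eventually_elim
      case (elim x)
      then have "summable (\<lambda>m. g m x)" by (rule summable_rabs_cancel)
      from suminf_split_initial_segment[OF this, of K] show ?case by simp
    qed
    have "L1_norm M (\<lambda>x. (\<Sum>m. g m x) - (\<Sum>m<K. g m x)) = L1_norm M (\<lambda>x. \<Sum>m. g (m + K) x)"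
      by (rule L1_norm_cong_AE)
        (use ae int in \<open>auto intro!: L1_integrable_suminf sK sum Bochner_Integration.integrable_diff\<close>)
    also have "\<dots> \<le> (\<Sum>m. L1_norm M (g (m + K)))"
      by (rule L1_norm_suminf_le) (use int sK in auto)
    finally show "L1_norm M (\<lambda>x. (\<Sum>m. g m x) - (\<Sum>m<K. g m x)) \<le> (\<Sum>m. L1_norm M (g (m + K)))" .
  qed
  show "(\<lambda>K. \<Sum>m. L1_norm M (g (m + K))) \<longlonglongrightarrow> 0"
    using suminf_exist_split2[OF sum] .
qed

section \<open>Differentiable curves in \<open>L\<^sup>1\<close>\<close>

lemma L1_has_derivative_on_subset:
  assumes "L1_has_derivative_on M I f f'" "J \<subseteq> I"
  shows "L1_has_derivative_on M J f f'"
  using assms unfolding L1_has_derivative_on_def by (blast intro: tendsto_within_subset)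

lemma L1_has_derivative_on_cong_AE:
  assumes f: "\<And>t. t \<in> I \<Longrightarrow> integrable M (f t)"
    and f': "\<And>t. t \<in> I \<Longrightarrow> integrable M (f' t)" and g': "\<And>t. t \<in> I \<Longrightarrow> integrable M (g' t)"
    and ae: "\<And>t. t \<in> I \<Longrightarrow> AE x in M. f' t x = g' t x"
  shows "L1_has_derivative_on M I f f' \<longleftrightarrow> L1_has_derivative_on M I f g'"
proof -
  have "((\<lambda>s. L1_norm M (\<lambda>x. (f s x - f t x) / (s - t) - f' t x)) \<longlongrightarrow> 0) (at t within I)
     \<longleftrightarrow> ((\<lambda>s. L1_norm M (\<lambda>x. (f s x - f t x) / (s - t) - g' t x)) \<longlongrightarrow> 0) (at t within I)"
    if t: "t \<in> I" for t
  proof (rule tendsto_cong)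
    show "\<forall>\<^sub>F s in at t within I. L1_norm M (\<lambda>x. (f s x - f t x) / (s - t) - f' t x)
        = L1_norm M (\<lambda>x. (f s x - f t x) / (s - t) - g' t x)"
      unfolding eventually_at_filter
    proof (intro always_eventually allI impI)
      fix s assume s: "s \<in> I"
      show "L1_norm M (\<lambda>x. (f s x - f t x) / (s - t) - f' t x)
          = L1_norm M (\<lambda>x. (f s x - f t x) / (s - t) - g' t x)"
      proof (rule L1_norm_cong_AE)
        show "AE x in M. (f s x - f t x) / (s - t) - f' t x = (f s x - f t x) / (s - t) - g' t x"
          using ae[OF t] by eventually_elim simp
      qed (use f f' g' s t in auto)
    qed
  qed
  then show ?thesis unfolding L1_has_derivative_on_def using f f' g' by auto
qed

lemma L1_has_derivative_on_imp_continuous: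
  assumes d: "L1_has_derivative_on M I f f'" and t: "t \<in> I"
  shows "((\<lambda>s. L1_norm M (\<lambda>x. f s x - f t x)) \<longlongrightarrow> 0) (at t within I)"
proof (rule L1_norm_tendsto_zeroI)
  let ?q = "\<lambda>s. L1_norm M (\<lambda>x. (f s x - f t x) / (s - t) - f' t x)"
  have int: "integrable M (f s)" "integrable M (f' s)" if "s \<in> I" for s
    using d that by (auto simp: L1_has_derivative_on_def)
  show "\<forall>\<^sub>F s in at t within I. L1_norm M (\<lambda>x. f s x - f t x) \<le> \<bar>s - t\<bar> * (?q s + L1_norm M (f' t))"
    unfolding eventually_at_filter
  proof (intro always_eventually allI impI)
    fix s assume s: "s \<noteq> t" "s \<in> I"
    have "L1_norm M (\<lambda>x. f s x - f t x) = L1_norm M (\<lambda>x. (s - t) * ((f s x - f t x) / (s - t)))"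
      using s by simp
    also have "\<dots> = \<bar>s - t\<bar> * L1_norm M (\<lambda>x. ((f s x - f t x) / (s - t) - f' t x) + f' t x)"
      unfolding L1_norm_scale by simp
    also have "\<dots> \<le> \<bar>s - t\<bar> * (?q s + L1_norm M (f' t))"
      by (intro mult_left_mono L1_norm_triangle) (use int s t in auto)
    finally show "L1_norm M (\<lambda>x. f s x - f t x) \<le> \<bar>s - t\<bar> * (?q s + L1_norm M (f' t))" .
  qed
  have "((\<lambda>s. \<bar>s - t\<bar> * (?q s + L1_norm M (f' t))) \<longlongrightarrow> \<bar>t - t\<bar> * (0 + L1_norm M (f' t))) (at t within I)"
    using d t unfolding L1_has_derivative_on_def by (intro tendsto_intros) auto
  then show "((\<lambda>s. \<bar>s - t\<bar> * (?q s + L1_norm M (f' t))) \<longlongrightarrow> 0) (at t within I)" by simp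
qed

lemma L1_has_derivative_on_diff:
  assumes f: "L1_has_derivative_on M I f f'" and g: "L1_has_derivative_on M I g g'"
  shows "L1_has_derivative_on M I (\<lambda>t x. f t x - g t x) (\<lambda>t x. f' t x - g' t x)"
  unfolding L1_has_derivative_on_def
proof (intro conjI ballI)
  fix t assume t: "t \<in> I"
  have int: "integrable M (f s)" "integrable M (f' s)" "integrable M (g s)" "integrable M (g' s)"
    if "s \<in> I" for s
    using f g that by (auto simp: L1_has_derivative_on_def)
  then show "integrable M (\<lambda>x. f t x - g t x)" "integrable M (\<lambda>x. f' t x - g' t x)"
    using t by auto
  let ?qf = "\<lambda>s x. (f s x - f t x) / (s - t) - f' t x"
  let ?qg = "\<lambda>s x. (g s x - g t x) / (s - t) - g' t x"
  show "((\<lambda>s. L1_norm M (\<lambda>x. (f s x - g s x - (f t x - g t x)) / (s - t) - (f' t x - g' t x)))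
     \<longlongrightarrow> 0) (at t within I)"
  proof (rule L1_norm_tendsto_zeroI)
    show "\<forall>\<^sub>F s in at t within I.
       L1_norm M (\<lambda>x. (f s x - g s x - (f t x - g t x)) / (s - t) - (f' t x - g' t x))
        \<le> L1_norm M (?qf s) + L1_norm M (?qg s)"
      unfolding eventually_at_filter
    proof (intro always_eventually allI impI)
      fix s assume s: "s \<noteq> t" "s \<in> I"
      have "L1_norm M (\<lambda>x. ?qf s x - ?qg s x) \<le> L1_norm M (?qf s) + L1_norm M (?qg s)"
        by (intro L1_norm_triangle_diff) (use int s t in auto)
      moreover have "?qf s x - ?qg s x
          = (f s x - g s x - (f t x - g t x)) / (s - t) - (f' t x - g' t x)" for x
        by (simp add: diff_divide_distrib)
      ultimately show "L1_norm M (\<lambda>x. (f s x - g s x - (f t x - g t x)) / (s - t) - (f' t x - g' t x))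
        \<le> L1_norm M (?qf s) + L1_norm M (?qg s)" by simp
    qed
    show "((\<lambda>s. L1_norm M (?qf s) + L1_norm M (?qg s)) \<longlongrightarrow> 0) (at t within I)"
      using f g t unfolding L1_has_derivative_on_def by (auto intro!: tendsto_add_zero)
  qed
qed

text \<open>
  Pairing with a bounded function turns a curve in \<open>L\<^sup>1\<close> into a real function, to which the
  mean value theorem applies.
\<close>
lemma L1_has_derivative_on_integral_against_bounded:
  assumes d: "L1_has_derivative_on M I f f'" and t: "t \<in> I"
    and \<psi>[measurable]: "\<psi> \<in> borel_measurable M" and bd: "\<And>x. \<bar>\<psi> x\<bar> \<le> 1"
  shows "((\<lambda>s. LINT x|M. \<psi> x * f s x) has_real_derivative (LINT x|M. \<psi> x * f' t x)) (at t within I)"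
  unfolding has_field_derivative_iff
proof (rule Lim_null[THEN iffD2], rule Lim_null_comparison)
  let ?q = "\<lambda>s x. (f s x - f t x) / (s - t) - f' t x"
  have int: "integrable M (f s)" "integrable M (f' s)" if "s \<in> I" for s
    using d that by (auto simp: L1_has_derivative_on_def)
  note i\<psi> = integrable_bounded_mult[OF \<psi> bd]
  show "\<forall>\<^sub>F s in at t within I.
     norm (((LINT x|M. \<psi> x * f s x) - (LINT x|M. \<psi> x * f t x)) / (s - t) - (LINT x|M. \<psi> x * f' t x))
       \<le> L1_norm M (?q s)"
    unfolding eventually_at_filter
  proof (intro always_eventually allI impI)
    fix s assume s: "s \<noteq> t" "s \<in> I"
    have iq: "integrable M (?q s)" using int s t by auto
    have "((LINT x|M. \<psi> x * f s x) - (LINT x|M. \<psi> x * f t x)) / (s - t) - (LINT x|M. \<psi> x * f' t x)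
       = (LINT x|M. (\<psi> x * f s x - \<psi> x * f t x) / (s - t) - \<psi> x * f' t x)"
      using int[OF s(2)] int[OF t] by (simp add: i\<psi>)
    also have "\<dots> = (LINT x|M. \<psi> x * ?q s x)"
      by (rule Bochner_Integration.integral_cong) (use s in \<open>auto simp: field_simps\<close>)
    also have "norm \<dots> \<le> L1_norm M (?q s)"
      using abs_integral_bounded_mult_le[OF \<psi> bd iq] by simp
    finally show "norm (((LINT x|M. \<psi> x * f s x) - (LINT x|M. \<psi> x * f t x)) / (s - t)
        - (LINT x|M. \<psi> x * f' t x)) \<le> L1_norm M (?q s)" .
  qed
  show "((\<lambda>s. L1_norm M (?q s)) \<longlongrightarrow> 0) (at t within I)"
    using d t unfolding L1_has_derivative_on_def by auto
qed

lemma continuous_on_L1_norm: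
  assumes d: "L1_has_derivative_on M I f f'"
  shows "continuous_on I (\<lambda>t. L1_norm M (f t))"
  unfolding continuous_on
proof
  fix t assume t: "t \<in> I"
  have int: "integrable M (f s)" if "s \<in> I" for s
    using d that by (auto simp: L1_has_derivative_on_def)
  show "((\<lambda>t. L1_norm M (f t)) \<longlongrightarrow> L1_norm M (f t)) (at t within I)"
  proof (rule Lim_null[THEN iffD2], rule Lim_null_comparison)
    show "\<forall>\<^sub>F s in at t within I. norm (L1_norm M (f s) - L1_norm M (f t)) \<le> L1_norm M (\<lambda>x. f s x - f t x)"
      unfolding eventually_at_filter
    proof (intro always_eventually allI impI)
      fix s assume s: "s \<in> I"
      have "L1_norm M (\<lambda>x. (f s x - f t x) + f t x) \<le> L1_norm M (\<lambda>x. f s x - f t x) + L1_norm M (f t)"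
        by (rule L1_norm_triangle) (use int s t in auto)
      moreover have "L1_norm M (\<lambda>x. f s x - (f s x - f t x)) \<le> L1_norm M (f s) + L1_norm M (\<lambda>x. f s x - f t x)"
        by (rule L1_norm_triangle_diff) (use int s t in auto)
      ultimately show "norm (L1_norm M (f s) - L1_norm M (f t)) \<le> L1_norm M (\<lambda>x. f s x - f t x)"
        by simp
    qed
  qed (rule L1_has_derivative_on_imp_continuous[OF d t])
qed

text \<open>
  The norm of a differentiable curve need not be differentiable. At a time \<open>a\<close> that maximises the
  weighted norm \<open>\<phi>\<close>, the norm equals the pairing of \<open>f a\<close> with its sign; the derivative of the
  pairing of \<open>f t\<close> with this fixed sign is controlled by \<open>\<phi> a\<close>. Integrating from \<open>0\<close> to \<open>a\<close>
  yields \<open>\<phi> a \<le> \<phi> a / 2\<close>.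
\<close>
lemma L1_Gronwall_zero:
  assumes d: "L1_has_derivative_on M {0..b} f f'" and b: "0 \<le> b" and K: "0 < K"
    and le: "\<And>t. t \<in> {0..b} \<Longrightarrow> L1_norm M (f' t) \<le> K * L1_norm M (f t)"
    and z: "L1_norm M (f 0) = 0"
  shows "L1_norm M (f b) = 0"
proof -
  \<comment> \<open>The rate \<open>2 * K\<close>, twice the growth rate of the norm, is what produces the factor \<open>1 / 2\<close>.\<close>
  define \<phi> where "\<phi> t = exp (-(2 * K * t)) * L1_norm M (f t)" for t
  have int: "integrable M (f s)" "integrable M (f' s)" if "s \<in> {0..b}" for s
    using d that by (auto simp: L1_has_derivative_on_def)
  have "continuous_on {0..b} \<phi>"
    unfolding \<phi>_def by (intro continuous_intros continuous_on_L1_norm[OF d])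
  then obtain a where a: "a \<in> {0..b}" and max: "\<And>t. t \<in> {0..b} \<Longrightarrow> \<phi> t \<le> \<phi> a"
    using continuous_attains_sup[of "{0..b}" \<phi>] b by auto
  define m where "m = \<phi> a"
  have m0: "0 \<le> m" unfolding m_def \<phi>_def by (simp add: L1_norm_nonneg)
  have f_le: "L1_norm M (f t) \<le> m * exp (2 * K * t)" if "t \<in> {0..b}" for t
    using max[OF that] unfolding m_def[symmetric] by (simp add: \<phi>_def exp_minus field_simps)
  define \<psi> where "\<psi> x = sgn (f a x)" for x
  have \<psi>: "\<psi> \<in> borel_measurable M" using int(1)[OF a] unfolding \<psi>_def by auto
  have \<psi>1: "\<bar>\<psi> x\<bar> \<le> 1" for x unfolding \<psi>_def by (simp add: sgn_if)
  define G where "G t = (LINT x|M. \<psi> x * f t x)" for t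
  have dG: "(G has_real_derivative (LINT x|M. \<psi> x * f' t x)) (at t within {0..b})" if "t \<in> {0..b}" for t
    unfolding G_def using d that \<psi> \<psi>1 by (rule L1_has_derivative_on_integral_against_bounded)
  note bdG = abs_integral_bounded_mult_le[OF \<psi> \<psi>1]
  have "G a - m / 2 * exp (2 * K * a) \<le> G 0 - m / 2 * exp (2 * K * 0)"
  proof (rule DERIV_nonpos_imp_decreasing_open[where f = "\<lambda>t. G t - m / 2 * exp (2 * K * t)"])
    show "0 \<le> a" using a by simp
    show "continuous_on {0..a} (\<lambda>t. G t - m / 2 * exp (2 * K * t))"
    proof (intro continuous_intros)
      have "continuous_on {0..b} G" using dG by (meson DERIV_continuous continuous_on_eq_continuous_within)
      then show "continuous_on {0..a} G" by (rule continuous_on_subset) (use a in auto)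
    qed
    fix t assume t: "0 < t" "t < a"
    then have tb: "t \<in> {0..b}" and ti: "t \<in> interior {0..b}" using a by auto
    have "(G has_real_derivative (LINT x|M. \<psi> x * f' t x)) (at t)"
      using dG[OF tb] at_within_interior[OF ti] by simp
    then have "((\<lambda>t. G t - m / 2 * exp (2 * K * t)) has_real_derivative
        ((LINT x|M. \<psi> x * f' t x) - m * K * exp (2 * K * t))) (at t)"
      by (auto intro!: derivative_eq_intros)
    moreover have "(LINT x|M. \<psi> x * f' t x) \<le> m * K * exp (2 * K * t)"
    proof -
      have "(LINT x|M. \<psi> x * f' t x) \<le> K * L1_norm M (f t)"
        using bdG[OF int(2)[OF tb]] le[OF tb] by linarith
      also have "\<dots> \<le> K * (m * exp (2 * K * t))" using f_le[OF tb] K by simp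
      finally show ?thesis by (simp add: mult_ac)
    qed
    ultimately show "\<exists>y. ((\<lambda>t. G t - m / 2 * exp (2 * K * t)) has_real_derivative y) (at t) \<and> y \<le> 0"
      by (intro exI conjI) auto
  qed
  moreover have "G 0 \<le> 0" using bdG[OF int(1), of 0] z b by (auto simp: G_def)
  moreover have "G a = m * exp (2 * K * a)"
  proof -
    have "G a = L1_norm M (f a)" unfolding G_def \<psi>_def L1_norm_def by (simp add: abs_sgn mult.commute)
    then show ?thesis by (simp add: m_def \<phi>_def exp_minus field_simps)
  qed
  ultimately have "m * exp (2 * K * a) \<le> 0" using m0 by simp
  then have "m = 0" using m0 by (simp add: mult_le_0_iff)
  with f_le[of b] b show ?thesis using L1_norm_nonneg[of M "f b"] by auto
qed

section \<open>Quadratic equations with bounded collision operator\<close>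

definition tensor :: "('a \<Rightarrow> real) \<Rightarrow> ('a \<Rightarrow> real) \<Rightarrow> 'a \<times> 'a \<Rightarrow> real" where
  "tensor f g = (\<lambda>p. f (fst p) * g (snd p))"

context sigma_finite_measure
begin

lemma
  assumes f: "integrable M f" and g: "integrable M g"
  shows tensor_integrable: "integrable (M \<Otimes>\<^sub>M M) (tensor f g)"
    and integral_tensor: "(LINT p|(M \<Otimes>\<^sub>M M). tensor f g p) = (LINT x|M. f x) * (LINT x|M. g x)"
    and L1_norm_tensor: "L1_norm (M \<Otimes>\<^sub>M M) (tensor f g) = L1_norm M f * L1_norm M g"
proof -
  interpret MM: pair_sigma_finite M M ..
  have int: "integrable (M \<Otimes>\<^sub>M M) (tensor f g)" if "integrable M f" "integrable M g" for f g
  proof (rule MM.Fubini_integrable)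
    show "tensor f g \<in> borel_measurable (M \<Otimes>\<^sub>M M)"
      using that by (auto simp: tensor_def)
  qed (use that in \<open>auto simp: tensor_def abs_mult\<close>)
  have eq: "(LINT p|(M \<Otimes>\<^sub>M M). tensor f g p) = (LINT x|M. f x) * (LINT x|M. g x)"
    if "integrable M f" "integrable M g" for f g
    using MM.integral_fst'[OF int[OF that]] that by (simp add: tensor_def)
  show "integrable (M \<Otimes>\<^sub>M M) (tensor f g)" by (rule int[OF f g])
  show "(LINT p|(M \<Otimes>\<^sub>M M). tensor f g p) = (LINT x|M. f x) * (LINT x|M. g x)" by (rule eq[OF f g])
  have "L1_norm (M \<Otimes>\<^sub>M M) (tensor f g) = (LINT p|(M \<Otimes>\<^sub>M M). tensor (\<lambda>x. \<bar>f x\<bar>) (\<lambda>x. \<bar>g x\<bar>) p)"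
    by (simp add: L1_norm_def tensor_def abs_mult)
  also have "\<dots> = L1_norm M f * L1_norm M g"
    using eq[of "\<lambda>x. \<bar>f x\<bar>" "\<lambda>x. \<bar>g x\<bar>"] f g by (simp add: L1_norm_def)
  finally show "L1_norm (M \<Otimes>\<^sub>M M) (tensor f g) = L1_norm M f * L1_norm M g" .
qed

lemma AE_pair_fst_snd:
  assumes "AE x in M. R x"
  shows "AE p in M \<Otimes>\<^sub>M M. R (fst p) \<and> R (snd p)"
proof -
  interpret MM: pair_sigma_finite M M ..
  from assms obtain N where N: "{x \<in> space M. \<not> R x} \<subseteq> N" "emeasure M N = 0" "N \<in> sets M"
    unfolding eventually_ae_filter by (auto simp: null_sets_def)
  have aeN: "AE x in M. x \<notin> N" using N by (intro AE_not_in) auto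
  have [measurable]: "N \<in> sets M" by (fact N)
  have "AE p in M \<Otimes>\<^sub>M M. fst p \<notin> N \<and> snd p \<notin> N"
  proof (rule MM.AE_pair_measure)
    show "{p \<in> space (M \<Otimes>\<^sub>M M). fst p \<notin> N \<and> snd p \<notin> N} \<in> sets (M \<Otimes>\<^sub>M M)" by measurable
    show "AE x in M. AE y in M. fst (x, y) \<notin> N \<and> snd (x, y) \<notin> N"
      using aeN by (auto elim: AE_mp)
  qed
  then show ?thesis
    by (rule AE_mp) (rule AE_I2, use N in \<open>auto simp: space_pair_measure\<close>)
qed

end

text \<open>
  What the solution theory needs to know about the collisions: \<open>P\<close> is, up to null sets, a linear operator
  \<open>L\<^sup>1(M \<times> M) \<rightarrow> L\<^sup>1(M)\<close> of norm at most \<open>C\<close> that multiplies the total mass by \<open>C\<close>. Its argument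
  stands for the joint density of the two partners of an encounter, so quadratic collision terms are
  \<open>P (tensor f f)\<close>.
\<close>
locale collision_operator = sigma_finite_measure M for M :: "'a measure" +
  fixes P :: "('a \<times> 'a \<Rightarrow> real) \<Rightarrow> 'a \<Rightarrow> real" and C :: real
  assumes C_pos: "0 < C"
    and P_integrable: "integrable (M \<Otimes>\<^sub>M M) h \<Longrightarrow> integrable M (P h)"
    and P_add: "integrable (M \<Otimes>\<^sub>M M) h \<Longrightarrow> integrable (M \<Otimes>\<^sub>M M) h' \<Longrightarrow>
          AE w in M. P (\<lambda>p. h p + h' p) w = P h w + P h' w"
    and P_scale: "integrable (M \<Otimes>\<^sub>M M) h \<Longrightarrow> AE w in M. P (\<lambda>p. c * h p) w = c * P h w"
    and P_norm: "integrable (M \<Otimes>\<^sub>M M) h \<Longrightarrow> L1_norm M (P h) \<le> C * L1_norm (M \<Otimes>\<^sub>M M) h"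
    and P_mass: "integrable (M \<Otimes>\<^sub>M M) h \<Longrightarrow> (LINT w|M. P h w) = C * (LINT p|(M \<Otimes>\<^sub>M M). h p)"
begin

lemma P_diff:
  assumes "integrable (M \<Otimes>\<^sub>M M) h" "integrable (M \<Otimes>\<^sub>M M) h'"
  shows "AE w in M. P (\<lambda>p. h p - h' p) w = P h w - P h' w"
  using P_add[of h "\<lambda>p. -1 * h' p"] P_scale[of h' "-1"] assms by auto

lemma P_sum:
  assumes "finite A" "\<And>j. j \<in> A \<Longrightarrow> integrable (M \<Otimes>\<^sub>M M) (h j)"
  shows "AE w in M. P (\<lambda>p. \<Sum>j\<in>A. h j p) w = (\<Sum>j\<in>A. P (h j) w)"
  using assms
proof (induction rule: finite_induct)
  case empty
  show ?case using P_scale[of "\<lambda>_. 0" 0] by simp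
next
  case (insert a A)
  have "AE w in M. P (\<lambda>p. h a p + (\<Sum>j\<in>A. h j p)) w = P (h a) w + P (\<lambda>p. \<Sum>j\<in>A. h j p) w"
    by (rule P_add) (use insert in auto)
  with insert show ?case by fastforce
qed

lemma P_norm_diff_le:
  assumes "integrable (M \<Otimes>\<^sub>M M) h" "integrable (M \<Otimes>\<^sub>M M) h'"
  shows "L1_norm M (\<lambda>w. P h w - P h' w) \<le> C * L1_norm (M \<Otimes>\<^sub>M M) (\<lambda>p. h p - h' p)"
proof -
  have "L1_norm M (\<lambda>w. P h w - P h' w) = L1_norm M (P (\<lambda>p. h p - h' p))"
    by (rule L1_norm_cong_AE) (use P_diff[OF assms] assms P_integrable in auto)
  also have "\<dots> \<le> C * L1_norm (M \<Otimes>\<^sub>M M) (\<lambda>p. h p - h' p)"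
    by (rule P_norm) (use assms in auto)
  finally show ?thesis .
qed

lemma P_cong_AE:
  assumes i: "integrable (M \<Otimes>\<^sub>M M) h" "integrable (M \<Otimes>\<^sub>M M) h'" and ae: "AE p in M \<Otimes>\<^sub>M M. h p = h' p"
  shows "AE w in M. P h w = P h' w"
proof (rule AE_eq_if_L1_norm_diff_zero)
  have "L1_norm (M \<Otimes>\<^sub>M M) (\<lambda>p. h p - h' p) = L1_norm (M \<Otimes>\<^sub>M M) (\<lambda>p. 0)"
    by (rule L1_norm_cong_AE) (use i ae in auto)
  with P_norm_diff_le[OF i] L1_norm_nonneg[of M] show "L1_norm M (\<lambda>x. P h x - P h' x) = 0"
    by (intro antisym) (auto simp: L1_norm_def)
qed (use i P_integrable in auto)

text \<open>
  Both sides are limits in \<open>L\<^sup>1(M)\<close> of the images of the partial sums: the left one because \<open>P\<close> is bounded,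
  the right one because \<open>\<Sum>m. P (h m)\<close> converges absolutely.
\<close>
lemma P_suminf:
  assumes i: "\<And>m::nat. integrable (M \<Otimes>\<^sub>M M) (h m)" and s: "summable (\<lambda>m. L1_norm (M \<Otimes>\<^sub>M M) (h m))"
  shows "AE w in M. P (\<lambda>p. \<Sum>m. h m p) w = (\<Sum>m. P (h m) w)"
proof (rule AE_eq_if_L1_norm_diff_zero)
  have iP: "integrable M (P (h m))" for m using i P_integrable by auto
  have iS: "integrable (M \<Otimes>\<^sub>M M) (\<lambda>p. \<Sum>m. h m p)" by (rule L1_integrable_suminf[OF i s])
  have sP: "summable (\<lambda>m. L1_norm M (P (h m)))"
    by (rule summable_comparison_test'[OF summable_mult[OF s, of C]])
       (use P_norm[OF i] L1_norm_nonneg[of M] in auto)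
  show iPS: "integrable M (P (\<lambda>p. \<Sum>m. h m p))" by (rule P_integrable[OF iS])
  show iSP: "integrable M (\<lambda>w. \<Sum>m. P (h m) w)" by (rule L1_integrable_suminf[OF iP sP])
  have "(\<lambda>K::nat. L1_norm M (\<lambda>w. P (\<lambda>p. \<Sum>m. h m p) w - (\<Sum>m. P (h m) w))) \<longlonglongrightarrow> 0"
  proof (rule L1_norm_tendsto_zeroI)
    let ?a = "\<lambda>K. C * L1_norm (M \<Otimes>\<^sub>M M) (\<lambda>p. (\<Sum>m. h m p) - (\<Sum>m<K. h m p))"
    let ?b = "\<lambda>K. L1_norm M (\<lambda>w. (\<Sum>m. P (h m) w) - (\<Sum>m<K. P (h m) w))"
    show "\<forall>\<^sub>F K in sequentially.
        L1_norm M (\<lambda>w. P (\<lambda>p. \<Sum>m. h m p) w - (\<Sum>m. P (h m) w)) \<le> ?a K + ?b K"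
    proof (intro always_eventually allI)
      fix K
      let ?S = "\<lambda>p. \<Sum>m<K. h m p"
      have iSK: "integrable (M \<Otimes>\<^sub>M M) ?S" using i by auto
      have "L1_norm M (\<lambda>w. P (\<lambda>p. \<Sum>m. h m p) w - (\<Sum>m. P (h m) w))
         \<le> L1_norm M (\<lambda>w. P (\<lambda>p. \<Sum>m. h m p) w - P ?S w) + L1_norm M (\<lambda>w. P ?S w - (\<Sum>m. P (h m) w))"
        by (rule L1_norm_triangle3) (use iPS iSP iSK P_integrable in auto)
      also have "L1_norm M (\<lambda>w. P (\<lambda>p. \<Sum>m. h m p) w - P ?S w) \<le> ?a K"
        by (rule P_norm_diff_le[OF iS iSK])
      also have "L1_norm M (\<lambda>w. P ?S w - (\<Sum>m. P (h m) w)) = L1_norm M (\<lambda>w. (\<Sum>m<K. P (h m) w) - (\<Sum>m. P (h m) w))"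
        by (rule L1_norm_cong_AE) (use P_sum[of "{..<K}" h] i iSP iSK iP P_integrable in auto)
      also have "\<dots> = ?b K" by (rule L1_norm_minus_commute)
      finally show "L1_norm M (\<lambda>w. P (\<lambda>p. \<Sum>m. h m p) w - (\<Sum>m. P (h m) w)) \<le> ?a K + ?b K" by simp
    qed
    show "(\<lambda>K. ?a K + ?b K) \<longlonglongrightarrow> 0"
      by (intro tendsto_add_zero tendsto_mult_right_zero L1_partial_sums_converge i s iP sP)
  qed
  then show "L1_norm M (\<lambda>w. P (\<lambda>p. \<Sum>m. h m p) w - (\<Sum>m. P (h m) w)) = 0"
    using LIMSEQ_const_iff by blast
qed

text \<open>
  On densities of mass one this is \<open>P (tensor f f) - C * f\<close>. The factor \<open>LINT x|M. f x\<close> keeps the expression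
  purely quadratic, so that it agrees with the kinetic equation for densities of any mass.
\<close>
definition collision_rhs :: "('a \<Rightarrow> real) \<Rightarrow> 'a \<Rightarrow> real" where
  "collision_rhs f w = P (tensor f f) w - C * (LINT x|M. f x) * f w"

lemma collision_rhs_integrable:
  assumes "integrable M f"
  shows "integrable M (collision_rhs f)"
  unfolding collision_rhs_def using assms by (auto intro!: P_integrable tensor_integrable)

text \<open>
  From \<open>f \<otimes> f - g \<otimes> g = f \<otimes> (f - g) + (f - g) \<otimes> g\<close>, and likewise for the product of \<open>f\<close> with its mass.
\<close>
lemma collision_rhs_Lipschitz:
  assumes f: "integrable M f" and g: "integrable M g"
  shows "L1_norm M (\<lambda>w. collision_rhs f w - collision_rhs g w)
      \<le> 2 * C * (L1_norm M f + L1_norm M g) * L1_norm M (\<lambda>x. f x - g x)"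
proof -
  let ?d = "\<lambda>x. f x - g x"
  have d: "integrable M ?d" using f g by auto
  note int = f g d tensor_integrable P_integrable
  have 1: "L1_norm M (\<lambda>w. P (tensor f f) w - P (tensor g g) w)
      \<le> C * ((L1_norm M f + L1_norm M g) * L1_norm M ?d)"
  proof -
    have "L1_norm (M \<Otimes>\<^sub>M M) (\<lambda>p. tensor f f p - tensor g g p)
        = L1_norm (M \<Otimes>\<^sub>M M) (\<lambda>p. tensor f ?d p + tensor ?d g p)"
      by (simp add: tensor_def algebra_simps)
    also have "\<dots> \<le> L1_norm (M \<Otimes>\<^sub>M M) (tensor f ?d) + L1_norm (M \<Otimes>\<^sub>M M) (tensor ?d g)"
      by (rule L1_norm_triangle) (intro int)+
    also have "\<dots> = (L1_norm M f + L1_norm M g) * L1_norm M ?d"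
      by (simp add: L1_norm_tensor[OF f d] L1_norm_tensor[OF d g] algebra_simps)
    finally show ?thesis
      using P_norm_diff_le[OF tensor_integrable[OF f f] tensor_integrable[OF g g]] C_pos
      by (meson less_imp_le mult_left_mono order_trans)
  qed
  have 2: "L1_norm M (\<lambda>w. C * (LINT x|M. f x) * f w - C * (LINT x|M. g x) * g w)
      \<le> C * ((L1_norm M f + L1_norm M g) * L1_norm M ?d)"
  proof -
    have "L1_norm M (\<lambda>w. C * (LINT x|M. f x) * f w - C * (LINT x|M. g x) * g w)
        = L1_norm M (\<lambda>w. C * (LINT x|M. f x) * ?d w + C * (LINT x|M. ?d x) * g w)"
      using f g by (simp add: algebra_simps)
    also have "\<dots> \<le> L1_norm M (\<lambda>w. C * (LINT x|M. f x) * ?d w) + L1_norm M (\<lambda>w. C * (LINT x|M. ?d x) * g w)"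
      by (rule L1_norm_triangle) (use f g in auto)
    also have "\<dots> = C * (\<bar>LINT x|M. f x\<bar> * L1_norm M ?d + \<bar>LINT x|M. ?d x\<bar> * L1_norm M g)"
      unfolding L1_norm_scale using C_pos by (simp add: abs_mult algebra_simps)
    also have "\<dots> \<le> C * (L1_norm M f * L1_norm M ?d + L1_norm M ?d * L1_norm M g)"
      using C_pos by (intro mult_left_mono add_mono mult_right_mono abs_integral_le_L1_norm)
        (auto simp: L1_norm_nonneg)
    finally show ?thesis by (simp add: algebra_simps)
  qed
  have "L1_norm M (\<lambda>w. collision_rhs f w - collision_rhs g w)
     = L1_norm M (\<lambda>w. (P (tensor f f) w - P (tensor g g) w)
         - (C * (LINT x|M. f x) * f w - C * (LINT x|M. g x) * g w))"
    by (simp add: collision_rhs_def algebra_simps)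
  also have "\<dots> \<le> L1_norm M (\<lambda>w. P (tensor f f) w - P (tensor g g) w)
       + L1_norm M (\<lambda>w. C * (LINT x|M. f x) * f w - C * (LINT x|M. g x) * g w)"
    by (rule L1_norm_triangle_diff) (use int in auto)
  finally show ?thesis using 1 2 by simp
qed

lemma collision_rhs_continuous:
  assumes d: "L1_has_derivative_on M I f f'" and t: "t \<in> I"
  shows "((\<lambda>s. L1_norm M (\<lambda>w. collision_rhs (f s) w - collision_rhs (f t) w)) \<longlongrightarrow> 0) (at t within I)"
proof (rule L1_norm_tendsto_zeroI)
  have int: "integrable M (f s)" if "s \<in> I" for s
    using d that by (auto simp: L1_has_derivative_on_def)
  show "\<forall>\<^sub>F s in at t within I. L1_norm M (\<lambda>w. collision_rhs (f s) w - collision_rhs (f t) w)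
     \<le> 2 * C * (L1_norm M (f s) + L1_norm M (f t)) * L1_norm M (\<lambda>x. f s x - f t x)"
    unfolding eventually_at_filter
    by (intro always_eventually allI impI collision_rhs_Lipschitz int t)
  have "((\<lambda>s. L1_norm M (f s)) \<longlongrightarrow> L1_norm M (f t)) (at t within I)"
    using continuous_on_L1_norm[OF d] t by (auto simp: continuous_on)
  from tendsto_mult[OF tendsto_mult[OF tendsto_const tendsto_add[OF this tendsto_const]]
      L1_has_derivative_on_imp_continuous[OF d t]]
  show "((\<lambda>s. 2 * C * (L1_norm M (f s) + L1_norm M (f t)) * L1_norm M (\<lambda>x. f s x - f t x)) \<longlongrightarrow> 0)
     (at t within I)"
    by simp
qed

text \<open>
  Both solutions are bounded on the compact time interval, so the local Lipschitz estimate
  becomes a linear differential inequality for the norm of their difference.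
\<close>
theorem collision_solution_unique:
  assumes f: "L1_has_derivative_on M {0..b} f (\<lambda>t. collision_rhs (f t))"
    and g: "L1_has_derivative_on M {0..b} g (\<lambda>t. collision_rhs (g t))"
    and init: "AE x in M. f 0 x = g 0 x" and b: "0 \<le> b"
  shows "AE x in M. f b x = g b x"
proof -
  have int: "integrable M (f s)" "integrable M (g s)" if "s \<in> {0..b}" for s
    using f g that by (auto simp: L1_has_derivative_on_def)
  have bdd: "\<exists>B. \<forall>t\<in>{0..b}. L1_norm M (u t) \<le> B"
    if "L1_has_derivative_on M {0..b} u u'" for u u'
    using continuous_attains_sup[OF _ _ continuous_on_L1_norm[OF that]] b by auto
  obtain Bf Bg where B: "\<And>t. t \<in> {0..b} \<Longrightarrow> L1_norm M (f t) \<le> Bf" "\<And>t. t \<in> {0..b} \<Longrightarrow> L1_norm M (g t) \<le> Bg"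
    using bdd[OF f] bdd[OF g] by blast
  have B0: "0 \<le> Bf" "0 \<le> Bg" using B[of 0] b L1_norm_nonneg[of M] by (auto intro: order_trans)
  have "L1_norm M (\<lambda>x. f b x - g b x) = 0"
  proof (rule L1_Gronwall_zero[OF L1_has_derivative_on_diff[OF f g] b])
    show "0 < 2 * C * (Bf + Bg + 1)" using C_pos B0 by (simp add: add_nonneg_pos)
    fix t assume t: "t \<in> {0..b}"
    have "L1_norm M (\<lambda>w. collision_rhs (f t) w - collision_rhs (g t) w)
        \<le> 2 * C * (L1_norm M (f t) + L1_norm M (g t)) * L1_norm M (\<lambda>x. f t x - g t x)"
      by (rule collision_rhs_Lipschitz) (use int t in auto)
    also have "\<dots> \<le> 2 * C * (Bf + Bg + 1) * L1_norm M (\<lambda>x. f t x - g t x)"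
      using B[OF t] C_pos by (intro mult_right_mono mult_left_mono) (auto simp: L1_norm_nonneg)
    finally show "L1_norm M (\<lambda>w. collision_rhs (f t) w - collision_rhs (g t) w)
       \<le> 2 * C * (Bf + Bg + 1) * L1_norm M (\<lambda>x. f t x - g t x)" .
  next
    have "L1_norm M (\<lambda>x. f 0 x - g 0 x) = L1_norm M (\<lambda>x. 0)"
      by (rule L1_norm_cong_AE) (use int[of 0] b init in auto)
    then show "L1_norm M (\<lambda>x. f 0 x - g 0 x) = 0" by (simp add: L1_norm_def)
  qed
  then show ?thesis using int[of b] b by (intro AE_eq_if_L1_norm_diff_zero) auto
qed

section \<open>The Wild sum\<close>

text \<open>
  With \<open>s = 1 - exp (- C * t)\<close> and \<open>f t = (1 - s) * G s\<close>, the equation \<open>f' = P (f \<otimes> f) - C * f\<close> becomes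
  \<open>C * G' s = P (G s \<otimes> G s)\<close>. The functions below are the coefficients of its power series solution
  \<open>G s = (\<Sum>m. s ^ m * wild_term f0 m)\<close>.
\<close>
context
  \<comment> \<open>The congruence rule supplies \<open>j \<le> m\<close> for the recursive calls under the sum.\<close>
  notes sum.cong[fundef_cong]
begin

fun wild_term :: "('a \<Rightarrow> real) \<Rightarrow> nat \<Rightarrow> 'a \<Rightarrow> real" where
  "wild_term f0 0 = f0"
| "wild_term f0 (Suc m) =
     (\<lambda>x. (\<Sum>j\<in>{..m}. P (tensor (wild_term f0 j) (wild_term f0 (m - j))) x) / (C * real (Suc m)))"

end

lemma wild_term_integrable:
  assumes "integrable M f0"
  shows "integrable M (wild_term f0 m)"
proof (induction m rule: less_induct)
  case (less m)
  show ?case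
  proof (cases m)
    case (Suc k)
    have "integrable M (P (tensor (wild_term f0 j) (wild_term f0 (k - j))))" if "j \<le> k" for j
      by (intro P_integrable tensor_integrable less) (use that Suc in auto)
    then have "integrable M (\<lambda>x. \<Sum>j\<le>k. P (tensor (wild_term f0 j) (wild_term f0 (k - j))) x)"
      by (intro Bochner_Integration.integrable_sum) auto
    then show ?thesis using Suc by simp
  qed (use assms in simp)
qed

text \<open>
  The \<open>m + 1\<close> summands of the recursion have norm at most \<open>C\<close> each, which is exactly compensated by the divisor
  \<open>C * (m + 1)\<close>. Hence the radius of convergence in \<open>s\<close> is at least one, and every time
  \<open>t \<ge> 0\<close> lies inside it.
\<close>
lemma wild_term_norm_le:
  assumes i: "integrable M f0" and n: "L1_norm M f0 \<le> 1"
  shows "L1_norm M (wild_term f0 m) \<le> 1"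
proof (induction m rule: less_induct)
  case (less m)
  show ?case
  proof (cases m)
    case (Suc k)
    let ?h = "\<lambda>j. tensor (wild_term f0 j) (wild_term f0 (k - j))"
    have ih: "integrable (M \<Otimes>\<^sub>M M) (?h j)" for j
      by (intro tensor_integrable wild_term_integrable i)
    have "L1_norm M (P (?h j)) \<le> C" if "j \<le> k" for j
    proof -
      have "L1_norm M (P (?h j)) \<le> C * L1_norm (M \<Otimes>\<^sub>M M) (?h j)" by (rule P_norm[OF ih])
      also have "L1_norm (M \<Otimes>\<^sub>M M) (?h j) = L1_norm M (wild_term f0 j) * L1_norm M (wild_term f0 (k - j))"
        by (intro L1_norm_tensor wild_term_integrable i)
      also have "\<dots> \<le> 1"
        by (intro mult_le_one less L1_norm_nonneg) (use that Suc in auto)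
      finally show ?thesis using C_pos by (simp add: mult_left_mono)
    qed
    then have "(\<Sum>j\<in>{..k}. L1_norm M (P (?h j))) \<le> C * real (Suc k)"
      using sum_bounded_above[of "{..k}" "\<lambda>j. L1_norm M (P (?h j))" C] by (simp add: mult.commute)
    moreover have "L1_norm M (\<lambda>x. \<Sum>j\<in>{..k}. P (?h j) x) \<le> (\<Sum>j\<in>{..k}. L1_norm M (P (?h j)))"
      by (rule L1_norm_sum_le) (use ih P_integrable in auto)
    moreover have "L1_norm M (wild_term f0 m) = L1_norm M (\<lambda>x. \<Sum>j\<in>{..k}. P (?h j) x) / (C * real (Suc k))"
      using L1_norm_scale[of M "1 / (C * real (Suc k))"] C_pos Suc by simp
    moreover have "0 < C * real (Suc k)" using C_pos by simp
    ultimately show ?thesis by (simp only: divide_le_eq_1_pos)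
  qed (use n in simp)
qed

lemma wild_term_mass:
  assumes i: "integrable M f0" and n: "(LINT x|M. f0 x) = 1"
  shows "(LINT x|M. wild_term f0 m x) = 1"
proof (induction m rule: less_induct)
  case (less m)
  show ?case
  proof (cases m)
    case (Suc k)
    let ?h = "\<lambda>j. tensor (wild_term f0 j) (wild_term f0 (k - j))"
    have ih: "integrable (M \<Otimes>\<^sub>M M) (?h j)" for j
      by (intro tensor_integrable wild_term_integrable i)
    have "(LINT x|M. P (?h j) x) = C" if "j \<le> k" for j
    proof -
      have "(LINT p|(M \<Otimes>\<^sub>M M). ?h j p) = (LINT x|M. wild_term f0 j x) * (LINT x|M. wild_term f0 (k - j) x)"
        by (intro integral_tensor wild_term_integrable i)
      then show ?thesis using P_mass[OF ih] less[of j] less[of "k - j"] that Suc by simp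
    qed
    then have "(\<Sum>j\<in>{..k}. LINT x|M. P (?h j) x) = C * real (Suc k)" by simp
    then show ?thesis using Suc ih P_integrable C_pos by (simp del: of_nat_Suc)
  qed (use n in simp)
qed

text \<open>
  The weights \<open>(1 - s) * s ^ m\<close> of the Wild sum in terms of the time \<open>t\<close>, followed by their time derivatives.
  For \<open>t \<ge> 0\<close> they form a geometric probability distribution on the indices \<open>m\<close>.
\<close>
definition wild_coeff :: "nat \<Rightarrow> real \<Rightarrow> real" where
  "wild_coeff m t = exp (- C * t) * (1 - exp (- C * t)) ^ m"

definition wild_coeff' :: "nat \<Rightarrow> real \<Rightarrow> real" where
  "wild_coeff' m t = C * (exp (- C * t))\<^sup>2 * real m * (1 - exp (- C * t)) ^ (m - 1) - C * wild_coeff m t"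

definition wild_sum :: "('a \<Rightarrow> real) \<Rightarrow> real \<Rightarrow> 'a \<Rightarrow> real" where
  "wild_sum f0 t x = (\<Sum>m. wild_coeff m t * wild_term f0 m x)"

lemma wild_coeff_has_derivative:
  "(wild_coeff m has_real_derivative wild_coeff' m t) (at t)"
  unfolding wild_coeff_def[abs_def] wild_coeff'_def
  by (auto intro!: derivative_eq_intros simp: power2_eq_square algebra_simps)

lemma exp_bounds:
  assumes "0 \<le> t" "t \<le> b"
  shows "0 \<le> 1 - exp (- C * t)" "1 - exp (- C * t) \<le> 1 - exp (- C * b)" "exp (- C * t) \<le> 1"
  using assms C_pos by (auto simp: mult_left_mono)

lemma wild_coeff_nonneg: "0 \<le> t \<Longrightarrow> 0 \<le> wild_coeff m t"
  using exp_bounds[of t t] by (simp add: wild_coeff_def)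

lemma wild_coeff_sums: 
  assumes "0 \<le> t"
  shows "(\<lambda>m. wild_coeff m t) sums 1"
proof -
  have "(\<lambda>m. (1 - exp (- C * t)) ^ m) sums (1 / (1 - (1 - exp (- C * t))))"
    using exp_bounds[of t t] assms by (intro geometric_sums) auto
  from sums_mult[OF this, of "exp (- C * t)"] show ?thesis
    by (simp add: wild_coeff_def)
qed

lemma summable_nat_mult_power:
  assumes "0 \<le> r" "r < (1::real)"
  shows "summable (\<lambda>m. real m * r ^ (m - 1))"
proof -
  have "summable (\<lambda>m. diffs (\<lambda>_. 1) m * r ^ m)"
    by (rule termdiff_converges[of _ 1]) (use assms in auto)
  then have "summable (\<lambda>m. real (Suc m) * r ^ (Suc m - 1))" by (simp add: diffs_def)
  then show ?thesis by (subst (asm) summable_Suc_iff)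
qed

text \<open>
  A summable majorant, uniform on \<open>{0..b}\<close>, of the absolute values of the time derivatives of the weights.
\<close>
definition wild_bound :: "real \<Rightarrow> nat \<Rightarrow> real" where
  "wild_bound b m = C * (real m * (1 - exp (- C * b)) ^ (m - 1) + (1 - exp (- C * b)) ^ m)"

lemma summable_wild_bound:
  assumes "0 \<le> b"
  shows "summable (wild_bound b)"
  unfolding wild_bound_def[abs_def]
  using exp_bounds[of b b] assms
  by (intro summable_mult summable_add summable_nat_mult_power summable_geometric) auto

lemma wild_coeff'_bound:
  assumes t: "0 \<le> t" "t \<le> b"
  shows "\<bar>wild_coeff' m t\<bar> \<le> wild_bound b m"
proof -
  let ?e = "exp (- C * t)" and ?r = "1 - exp (- C * t)" and ?R = "1 - exp (- C * b)"
  note eb = exp_bounds[OF t]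
  have "C * ?e\<^sup>2 * real m * ?r ^ (m - 1) \<le> C * 1 * real m * ?R ^ (m - 1)"
    using eb C_pos by (intro mult_mono power_mono order_refl mult_right_mono mult_left_mono)
      (auto simp: power_le_one mult_nonneg_nonneg)
  moreover have "C * (?e * ?r ^ m) \<le> C * (1 * ?R ^ m)"
    using eb C_pos by (intro mult_mono power_mono order_refl) auto
  moreover have "0 \<le> C * ?e\<^sup>2 * real m * ?r ^ (m - 1)" "0 \<le> C * (?e * ?r ^ m)"
    using eb C_pos by (auto intro!: mult_nonneg_nonneg)
  ultimately show ?thesis
    unfolding wild_coeff'_def wild_coeff_def wild_bound_def by (simp add: algebra_simps abs_le_iff)
qed

lemma wild_coeff_diff_quotient_bound:
  assumes "t \<in> {0..b}" "s \<in> {0..b}" "s \<noteq> t"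
  shows "\<bar>(wild_coeff m s - wild_coeff m t) / (s - t)\<bar> \<le> wild_bound b m"
proof -
  have "norm (wild_coeff m s - wild_coeff m t) \<le> wild_bound b m * norm (s - t)"
    by (rule field_differentiable_bound[of "{0..b}" "wild_coeff m" "wild_coeff' m"])
       (use assms wild_coeff'_bound in \<open>auto intro: has_field_derivative_at_within wild_coeff_has_derivative\<close>)
  then show ?thesis using assms by (simp add: abs_divide divide_le_eq)
qed

lemma wild_coeff_remainder_bound:
  assumes "t \<in> {0..b}" "s \<in> {0..b}" "s \<noteq> t"
  shows "\<bar>(wild_coeff m s - wild_coeff m t) / (s - t) - wild_coeff' m t\<bar> \<le> 2 * wild_bound b m"
proof -
  have "0 \<le> t" "t \<le> b" using assms by auto
  from wild_coeff_diff_quotient_bound[OF assms, of m] wild_coeff'_bound[OF this, of m]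
  show ?thesis by linarith
qed

lemma wild_series:
  assumes i: "integrable M f0" and n: "L1_norm M f0 \<le> 1" and s: "summable (\<lambda>m. \<bar>c m\<bar>)"
  shows "integrable M (\<lambda>x. c m * wild_term f0 m x)"
    and "summable (\<lambda>m. L1_norm M (\<lambda>x. c m * wild_term f0 m x))"
    and "L1_norm M (\<lambda>x. \<Sum>m. c m * wild_term f0 m x) \<le> (\<Sum>m. \<bar>c m\<bar>)"
    and "integrable M (\<lambda>x. \<Sum>m. c m * wild_term f0 m x)"
    and "AE x in M. summable (\<lambda>m. \<bar>c m * wild_term f0 m x\<bar>)"
proof -
  show int: "integrable M (\<lambda>x. c m * wild_term f0 m x)" for m
    using wild_term_integrable[OF i] by auto
  have le: "L1_norm M (\<lambda>x. c m * wild_term f0 m x) \<le> \<bar>c m\<bar>" for m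
    unfolding L1_norm_scale using wild_term_norm_le[OF i n, of m] L1_norm_nonneg[of M]
    by (simp add: mult_left_le)
  show sum: "summable (\<lambda>m. L1_norm M (\<lambda>x. c m * wild_term f0 m x))"
    by (rule summable_comparison_test'[OF s]) (use le L1_norm_nonneg[of M] in auto)
  show "L1_norm M (\<lambda>x. \<Sum>m. c m * wild_term f0 m x) \<le> (\<Sum>m. \<bar>c m\<bar>)"
    using L1_norm_suminf_le[OF int sum] suminf_le[OF le sum s] by linarith
  show "integrable M (\<lambda>x. \<Sum>m. c m * wild_term f0 m x)"
    by (rule L1_integrable_suminf[OF int sum])
  show "AE x in M. summable (\<lambda>m. \<bar>c m * wild_term f0 m x\<bar>)"
    by (rule AE_summable_if_summable_L1_norm[OF int sum])
qed

lemma summable_abs_wild_coeff: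
  assumes "0 \<le> t" shows "summable (\<lambda>m. \<bar>wild_coeff m t\<bar>)"
  using wild_coeff_sums[OF assms] wild_coeff_nonneg[OF assms] by (simp add: sums_iff)

lemma summable_abs_wild_coeff':
  assumes "0 \<le> t" shows "summable (\<lambda>m. \<bar>wild_coeff' m t\<bar>)"
  by (rule summable_comparison_test'[OF summable_wild_bound[OF assms]])
     (use wild_coeff'_bound[of t t] assms in auto)

text \<open>
  Since every \<open>wild_term f0 m\<close> has norm at most one, the norm is dominated by a scalar series whose terms are the
  errors of the difference quotients of the weights. Each error tends to zero, and \<open>wild_bound\<close> provides the
  domination that lets Tannery's theorem exchange limit and sum.
\<close>
lemma wild_sum_diff_quotient:
  assumes i: "integrable M f0" and n: "L1_norm M f0 \<le> 1" and t: "t \<in> {0..b}" and b: "0 < b"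
  shows "((\<lambda>s. L1_norm M (\<lambda>x. (wild_sum f0 s x - wild_sum f0 t x) / (s - t)
            - (\<Sum>m. wild_coeff' m t * wild_term f0 m x))) \<longlongrightarrow> 0) (at t within {0..b})"
proof (rule L1_norm_tendsto_zeroI)
  let ?a = "\<lambda>s m. (wild_coeff m s - wild_coeff m t) / (s - t) - wild_coeff' m t"
  have sa: "summable (\<lambda>m. \<bar>?a s m\<bar>)" if "s \<in> {0..b}" "s \<noteq> t" for s
  proof (rule summable_comparison_test')
    show "summable (\<lambda>m. 2 * wild_bound b m)" using b by (intro summable_mult summable_wild_bound) simp
    show "norm \<bar>?a s m\<bar> \<le> 2 * wild_bound b m" for m
      using wild_coeff_remainder_bound[OF t that] by simp
  qed
  show "\<forall>\<^sub>F s in at t within {0..b}. L1_norm M (\<lambda>x. (wild_sum f0 s x - wild_sum f0 t x) / (s - t)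
            - (\<Sum>m. wild_coeff' m t * wild_term f0 m x)) \<le> (\<Sum>m. \<bar>?a s m\<bar>)"
    unfolding eventually_at_filter
  proof (intro always_eventually allI impI)
    fix s assume s: "s \<noteq> t" "s \<in> {0..b}"
    have s0: "0 \<le> s" and t0: "0 \<le> t" using s t by auto
    note w = wild_series[OF i n]
    note ss = summable_abs_wild_coeff[OF s0] and st = summable_abs_wild_coeff[OF t0]
      and st' = summable_abs_wild_coeff'[OF t0] and sa' = sa[OF s(2,1)]
    have ae: "AE x in M. (wild_sum f0 s x - wild_sum f0 t x) / (s - t)
            - (\<Sum>m. wild_coeff' m t * wild_term f0 m x) = (\<Sum>m. ?a s m * wild_term f0 m x)"
      using w(5)[OF ss] w(5)[OF st] w(5)[OF st']
    proof eventually_elim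
      case (elim x)
      have "(\<lambda>m. (wild_coeff m s * wild_term f0 m x - wild_coeff m t * wild_term f0 m x) / (s - t)
            - wild_coeff' m t * wild_term f0 m x) sums
          ((wild_sum f0 s x - wild_sum f0 t x) / (s - t) - (\<Sum>m. wild_coeff' m t * wild_term f0 m x))"
        unfolding wild_sum_def
        by (intro sums_diff sums_divide summable_sums elim[THEN summable_rabs_cancel])
      then show ?case
        by (simp add: sums_iff left_diff_distrib diff_divide_distrib)
    qed
    have "L1_norm M (\<lambda>x. (wild_sum f0 s x - wild_sum f0 t x) / (s - t)
            - (\<Sum>m. wild_coeff' m t * wild_term f0 m x)) = L1_norm M (\<lambda>x. \<Sum>m. ?a s m * wild_term f0 m x)"
      by (rule L1_norm_cong_AE)
        (use w(4)[OF ss] w(4)[OF st] w(4)[OF st'] w(4)[OF sa'] ae in \<open>auto simp: wild_sum_def\<close>)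
    also have "\<dots> \<le> (\<Sum>m. \<bar>?a s m\<bar>)" by (rule w(3)[OF sa'])
    finally show "L1_norm M (\<lambda>x. (wild_sum f0 s x - wild_sum f0 t x) / (s - t)
            - (\<Sum>m. wild_coeff' m t * wild_term f0 m x)) \<le> (\<Sum>m. \<bar>?a s m\<bar>)" .
  qed
  have "((\<lambda>s. \<Sum>m. \<bar>?a s m\<bar>) \<longlongrightarrow> (\<Sum>m. 0)) (at t within {0..b})"
  proof (rule tannerys_theorem[where M = "\<lambda>m. 2 * wild_bound b m", THEN conjunct2, THEN conjunct2])
    fix m
    have "((\<lambda>s. (wild_coeff m s - wild_coeff m t) / (s - t)) \<longlongrightarrow> wild_coeff' m t) (at t within {0..b})"
      using has_field_derivative_at_within[OF wild_coeff_has_derivative]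
      by (simp only: has_field_derivative_iff)
    then show "((\<lambda>s. \<bar>?a s m\<bar>) \<longlongrightarrow> 0) (at t within {0..b})"
      by (intro tendsto_rabs_zero) (rule Lim_null[THEN iffD1])
  next
    show "summable (\<lambda>m. 2 * wild_bound b m)" using b by (intro summable_mult summable_wild_bound) simp
    show "at t within {0..b} \<noteq> bot" using t b by (simp add: trivial_limit_within islimpt_Icc)
    show "\<forall>\<^sub>F (k, s) in at_top \<times>\<^sub>F (at t within {0..b}). norm \<bar>?a s k\<bar> \<le> 2 * wild_bound b k"
    proof -
      have "\<forall>\<^sub>F s in at t within {0..b}. \<forall>k. norm \<bar>?a s k\<bar> \<le> 2 * wild_bound b k"
        unfolding eventually_at_filter
        using wild_coeff_remainder_bound[OF t] by (intro always_eventually allI impI) simp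
      from eventually_prodI[OF always_eventually this, of "\<lambda>_. True" at_top] show ?thesis
        by (auto elim!: eventually_mono)
    qed
  qed
  then show "((\<lambda>s. \<Sum>m. \<bar>?a s m\<bar>) \<longlongrightarrow> 0) (at t within {0..b})" by simp
qed

lemma wild_sum_mass:
  assumes i: "integrable M f0" and n: "L1_norm M f0 \<le> 1" and m: "(LINT x|M. f0 x) = 1" and t: "0 \<le> t"
  shows "(LINT x|M. wild_sum f0 t x) = 1"
proof -
  note w = wild_series[OF i n summable_abs_wild_coeff[OF t]]
  have "(\<lambda>m. LINT x|M. wild_coeff m t * wild_term f0 m x) sums (LINT x|M. wild_sum f0 t x)"
    unfolding wild_sum_def by (rule L1_integral_sums[OF w(1,2)])
  then have "(\<lambda>m. wild_coeff m t) sums (LINT x|M. wild_sum f0 t x)"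
    using wild_term_mass[OF i m] by simp
  with wild_coeff_sums[OF t] show ?thesis by (rule sums_unique2[symmetric])
qed

text \<open>
  Write \<open>s = 1 - exp (- C * t)\<close>, \<open>f\<close> for the Wild sum at time \<open>t\<close> and \<open>W\<close> for its terms. The Cauchy product
  expands \<open>f \<otimes> f\<close> into \<open>\<Sum>m. (1 - s)\<^sup>2 * s ^ m * (\<Sum>j\<le>m. W j \<otimes> W (m - j))\<close>, and
  the recursion of the Wild terms identifies the image of the inner sum under \<open>P\<close> as \<open>C * (m + 1) * W (m + 1)\<close>. On the right, the
  index is shifted by one; the term with \<open>m = 0\<close> vanishes.
\<close>
lemma P_tensor_wild_sum:
  assumes i: "integrable M f0" and n: "L1_norm M f0 \<le> 1" and t: "0 \<le> t"
  shows "AE w in M. P (tensor (wild_sum f0 t) (wild_sum f0 t)) w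
     = (\<Sum>m. (C * (exp (- C * t))\<^sup>2 * real m * (1 - exp (- C * t)) ^ (m - 1)) * wild_term f0 m w)"
proof -
  let ?e = "exp (- C * t)" and ?r = "1 - exp (- C * t)" and ?W = "wild_term f0"
  define h where "h m p = (\<Sum>j\<le>m. (wild_coeff j t * wild_coeff (m - j) t) * tensor (?W j) (?W (m - j)) p)" for m p
  note eb = exp_bounds[OF t order_refl]
  note w = wild_series[OF i n summable_abs_wild_coeff[OF t]]
  have iT: "integrable (M \<Otimes>\<^sub>M M) (tensor (?W j) (?W k))" for j k
    by (intro tensor_integrable wild_term_integrable i)
  have ih: "integrable (M \<Otimes>\<^sub>M M) (h m)" for m unfolding h_def using iT by auto
  have coeff: "wild_coeff j t * wild_coeff (m - j) t = ?e\<^sup>2 * ?r ^ m" if "j \<le> m" for j m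
    using that unfolding wild_coeff_def by (simp add: power2_eq_square flip: power_add)
  have h_eq: "h m p = (\<Sum>j\<le>m. (?e\<^sup>2 * ?r ^ m) * tensor (?W j) (?W (m - j)) p)" for m p
    unfolding h_def by (intro sum.cong refl) (simp only: coeff atMost_iff)
  have hn: "L1_norm (M \<Otimes>\<^sub>M M) (h m) \<le> real (Suc m) * ?r ^ m" for m
  proof -
    have "L1_norm (M \<Otimes>\<^sub>M M) (h m)
        \<le> (\<Sum>j\<le>m. L1_norm (M \<Otimes>\<^sub>M M) (\<lambda>p. (?e\<^sup>2 * ?r ^ m) * tensor (?W j) (?W (m - j)) p))"
      unfolding h_eq by (rule L1_norm_sum_le) (use iT in auto)
    also have "\<dots> \<le> (\<Sum>j\<le>m. ?r ^ m)"
    proof (rule sum_mono)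
      fix j
      have "L1_norm (M \<Otimes>\<^sub>M M) (tensor (?W j) (?W (m - j))) = L1_norm M (?W j) * L1_norm M (?W (m - j))"
        by (intro L1_norm_tensor wild_term_integrable i)
      also have "\<dots> \<le> 1" by (intro mult_le_one wild_term_norm_le i n L1_norm_nonneg)
      finally have *: "L1_norm (M \<Otimes>\<^sub>M M) (tensor (?W j) (?W (m - j))) \<le> 1" .
      have "(?e\<^sup>2 * ?r ^ m) * L1_norm (M \<Otimes>\<^sub>M M) (tensor (?W j) (?W (m - j))) \<le> (1 * ?r ^ m) * 1"
        using eb by (intro mult_mono *) (auto simp: L1_norm_nonneg power_le_one)
      then show "L1_norm (M \<Otimes>\<^sub>M M) (\<lambda>p. (?e\<^sup>2 * ?r ^ m) * tensor (?W j) (?W (m - j)) p) \<le> ?r ^ m"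
        unfolding L1_norm_scale using eb by (simp add: abs_mult)
    qed
    finally show ?thesis by simp
  qed
  have sh: "summable (\<lambda>m. L1_norm (M \<Otimes>\<^sub>M M) (h m))"
  proof (rule summable_comparison_test')
    have "summable (\<lambda>m. real m * ?r ^ (m - 1))" using eb by (intro summable_nat_mult_power) auto
    then have "summable (\<lambda>m. real (Suc m) * ?r ^ (Suc m - 1))" by (subst summable_Suc_iff)
    then show "summable (\<lambda>m. real (Suc m) * ?r ^ m)" by simp
    show "norm (L1_norm (M \<Otimes>\<^sub>M M) (h m)) \<le> real (Suc m) * ?r ^ m" for m
      using hn[of m] L1_norm_nonneg[of "M \<Otimes>\<^sub>M M" "h m"] by simp
  qed
  have "AE p in M \<Otimes>\<^sub>M M. tensor (wild_sum f0 t) (wild_sum f0 t) p = (\<Sum>m. h m p)"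
    using AE_pair_fst_snd[OF w(5)]
  proof eventually_elim
    case (elim p)
    have "(\<lambda>m. \<Sum>j\<le>m. (wild_coeff j t * ?W j (fst p)) * (wild_coeff (m - j) t * ?W (m - j) (snd p))) sums
       ((\<Sum>m. wild_coeff m t * ?W m (fst p)) * (\<Sum>m. wild_coeff m t * ?W m (snd p)))"
      by (rule Cauchy_product_sums) (use elim in auto)
    then show ?case
      by (simp add: sums_iff h_def tensor_def wild_sum_def mult_ac)
  qed
  then have 1: "AE w in M. P (tensor (wild_sum f0 t) (wild_sum f0 t)) w = P (\<lambda>p. \<Sum>m. h m p) w"
    by (intro P_cong_AE L1_integrable_suminf ih sh tensor_integrable)
       (use w(4) in \<open>auto simp: wild_sum_def[abs_def]\<close>)
  have 2: "AE w in M. P (\<lambda>p. \<Sum>m. h m p) w = (\<Sum>m. P (h m) w)" by (rule P_suminf[OF ih sh])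
  have 3: "AE w in M. \<forall>m. P (h m) w = (?e\<^sup>2 * ?r ^ m) * (C * real (Suc m)) * ?W (Suc m) w"
    unfolding AE_all_countable
  proof
    fix m
    have a: "AE w in M. P (h m) w = (\<Sum>j\<le>m. P (\<lambda>p. (?e\<^sup>2 * ?r ^ m) * tensor (?W j) (?W (m - j)) p) w)"
      unfolding h_eq[abs_def] by (rule P_sum) (use iT in auto)
    have "\<forall>j\<in>{..m}. AE w in M. P (\<lambda>p. (?e\<^sup>2 * ?r ^ m) * tensor (?W j) (?W (m - j)) p) w
        = (?e\<^sup>2 * ?r ^ m) * P (tensor (?W j) (?W (m - j))) w"
      by (intro ballI P_scale iT)
    then have "AE w in M. \<forall>j\<in>{..m}. P (\<lambda>p. (?e\<^sup>2 * ?r ^ m) * tensor (?W j) (?W (m - j)) p) w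
        = (?e\<^sup>2 * ?r ^ m) * P (tensor (?W j) (?W (m - j))) w"
      by (intro AE_finite_allI) auto
    with a show "AE w in M. P (h m) w = (?e\<^sup>2 * ?r ^ m) * (C * real (Suc m)) * ?W (Suc m) w"
    proof eventually_elim
      case (elim w)
      have "P (h m) w = (?e\<^sup>2 * ?r ^ m) * (\<Sum>j\<le>m. P (tensor (?W j) (?W (m - j))) w)"
        using elim by (simp add: sum_distrib_left)
      moreover have "(\<Sum>j\<le>m. P (tensor (?W j) (?W (m - j))) w) = (C * real (Suc m)) * ?W (Suc m) w"
        using C_pos by (simp del: of_nat_Suc)
      ultimately show ?case by (simp only: mult.assoc)
    qed
  qed
  let ?g = "\<lambda>m. C * ?e\<^sup>2 * real m * ?r ^ (m - 1)"
  have sg: "summable (\<lambda>m. \<bar>?g m\<bar>)"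
  proof -
    have "summable (\<lambda>m. (C * ?e\<^sup>2) * (real m * ?r ^ (m - 1)))"
      using eb by (intro summable_mult summable_nat_mult_power) auto
    moreover have "\<bar>?g m\<bar> = (C * ?e\<^sup>2) * (real m * ?r ^ (m - 1))" for m
      using eb C_pos by (simp add: abs_mult)
    ultimately show ?thesis by simp
  qed
  from 1 2 3 wild_series(5)[OF i n sg] show ?thesis
  proof eventually_elim
    case (elim w)
    have "summable (\<lambda>m. ?g m * ?W m w)" using elim(4) by (rule summable_rabs_cancel)
    from suminf_split_head[OF this] have "(\<Sum>m. ?g m * ?W m w) = (\<Sum>m. ?g (Suc m) * ?W (Suc m) w)"
      by simp
    also have "\<dots> = (\<Sum>m. P (h m) w)"
      using elim(3) by (simp add: mult_ac del: wild_term.simps of_nat_Suc)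
    finally show ?case using elim by simp
  qed
qed

text \<open>
  The termwise time derivative of the Wild sum is its collision term; mass conservation turns \<open>C * (LINT x|M. f x) * f\<close>
  into \<open>C * f\<close>.
\<close>
lemma collision_rhs_wild_sum:
  assumes i: "integrable M f0" and n: "L1_norm M f0 \<le> 1" and m: "(LINT x|M. f0 x) = 1" and t: "0 \<le> t"
  shows "AE w in M. collision_rhs (wild_sum f0 t) w = (\<Sum>m. wild_coeff' m t * wild_term f0 m w)"
  using P_tensor_wild_sum[OF i n t] wild_series(5)[OF i n summable_abs_wild_coeff[OF t]]
    wild_series(5)[OF i n summable_abs_wild_coeff'[OF t]]
proof eventually_elim
  case (elim w)
  let ?g = "\<lambda>m. C * (exp (- C * t))\<^sup>2 * real m * (1 - exp (- C * t)) ^ (m - 1)"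
  have c: "summable (\<lambda>m. wild_coeff m t * wild_term f0 m w)"
    and c': "summable (\<lambda>m. wild_coeff' m t * wild_term f0 m w)"
    using elim by (auto intro: summable_rabs_cancel)
  have g: "?g m * wild_term f0 m w = wild_coeff' m t * wild_term f0 m w + C * (wild_coeff m t * wild_term f0 m w)" for m
    by (simp add: wild_coeff'_def algebra_simps)
  have "(\<Sum>m. ?g m * wild_term f0 m w)
     = (\<Sum>m. wild_coeff' m t * wild_term f0 m w) + C * wild_sum f0 t w"
    unfolding g wild_sum_def
    by (simp only: suminf_add[OF c' summable_mult[OF c], symmetric] suminf_mult[OF c])
  then show ?case
    using elim(1) by (simp add: collision_rhs_def wild_sum_mass[OF i n m t])
qed

theorem wild_sum_solution:
  assumes i: "integrable M f0" and n: "L1_norm M f0 \<le> 1" and m: "(LINT x|M. f0 x) = 1"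
  shows "L1_has_derivative_on M {0..} (wild_sum f0) (\<lambda>t. collision_rhs (wild_sum f0 t))"
    and "wild_sum f0 0 = f0"
proof -
  have iw: "integrable M (wild_sum f0 t)" if "0 \<le> t" for t
    using wild_series(4)[OF i n summable_abs_wild_coeff[OF that]] by (simp add: wild_sum_def[abs_def])
  show "L1_has_derivative_on M {0..} (wild_sum f0) (\<lambda>t. collision_rhs (wild_sum f0 t))"
    unfolding L1_has_derivative_on_def
  proof (intro conjI ballI)
    fix t :: real assume "t \<in> {0..}"
    then have t: "0 \<le> t" by simp
    show "integrable M (wild_sum f0 t)" "integrable M (collision_rhs (wild_sum f0 t))"
      using iw[OF t] by (auto intro: collision_rhs_integrable)
    \<comment> \<open>The majorant of the weights is uniform on bounded time intervals only.\<close>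
    have "at t within {0..} = at t within {0..t+1}"
      by (rule at_within_nhd[of t "{..<t+1}"]) auto
    moreover have "((\<lambda>s. L1_norm M (\<lambda>x. (wild_sum f0 s x - wild_sum f0 t x) / (s - t)
        - collision_rhs (wild_sum f0 t) x)) \<longlongrightarrow> 0) (at t within {0..t+1})"
    proof (rule L1_norm_tendsto_zeroI)
      show "\<forall>\<^sub>F s in at t within {0..t+1}. L1_norm M (\<lambda>x. (wild_sum f0 s x - wild_sum f0 t x) / (s - t)
            - collision_rhs (wild_sum f0 t) x)
          \<le> L1_norm M (\<lambda>x. (wild_sum f0 s x - wild_sum f0 t x) / (s - t)
          - (\<Sum>m. wild_coeff' m t * wild_term f0 m x))"
        unfolding eventually_at_filter
      proof (intro always_eventually allI impI)
        fix s assume s: "s \<noteq> t" "s \<in> {0..t+1}"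
        have "integrable M (\<lambda>x. (wild_sum f0 s x - wild_sum f0 t x) / (s - t))"
          using iw[of s] iw[OF t] s by simp
        then show "L1_norm M (\<lambda>x. (wild_sum f0 s x - wild_sum f0 t x) / (s - t)
            - collision_rhs (wild_sum f0 t) x)
          \<le> L1_norm M (\<lambda>x. (wild_sum f0 s x - wild_sum f0 t x) / (s - t)
            - (\<Sum>m. wild_coeff' m t * wild_term f0 m x))"
          using collision_rhs_wild_sum[OF i n m t] wild_series(4)[OF i n summable_abs_wild_coeff'[OF t]]
            collision_rhs_integrable[OF iw[OF t]]
          by (intro eq_refl L1_norm_cong_AE) auto
      qed
      show "((\<lambda>s. L1_norm M (\<lambda>x. (wild_sum f0 s x - wild_sum f0 t x) / (s - t)
          - (\<Sum>m. wild_coeff' m t * wild_term f0 m x))) \<longlongrightarrow> 0) (at t within {0..t+1})"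
        by (rule wild_sum_diff_quotient[OF i n]) (use t in auto)
    qed
    ultimately show "((\<lambda>s. L1_norm M (\<lambda>x. (wild_sum f0 s x - wild_sum f0 t x) / (s - t)
        - collision_rhs (wild_sum f0 t) x)) \<longlongrightarrow> 0) (at t within {0..})"
      by simp
  qed
  show "wild_sum f0 0 = f0"
  proof
    fix x
    have "(\<lambda>m. wild_coeff m 0 * wild_term f0 m x) sums (\<Sum>m\<in>{0}. wild_coeff m 0 * wild_term f0 m x)"
      by (rule sums_finite) (auto simp: wild_coeff_def)
    then show "wild_sum f0 0 x = f0 x" by (simp add: sums_iff wild_sum_def wild_coeff_def)
  qed
qed

end

section \<open>Collision operators of interaction kernels\<close>

text \<open>
  \<open>E p\<close> is the rate of encounters of the pair \<open>p\<close>, and \<open>A p w\<close> is the rate at which such encounters turn the first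
  partner into an agent of state \<open>w\<close>; that the transition probabilities add up to one is the identity of \<open>E p\<close> with the
  total mass of \<open>A p\<close>.
\<close>
locale interaction_kernel = sigma_finite_measure M for M :: "'a measure" +
  fixes A :: "'a \<times> 'a \<Rightarrow> 'a \<Rightarrow> real" and E :: "'a \<times> 'a \<Rightarrow> real" and C :: real
  assumes kernel_measurable[measurable]: "case_prod A \<in> borel_measurable ((M \<Otimes>\<^sub>M M) \<Otimes>\<^sub>M M)"
    and rate_measurable[measurable]: "E \<in> borel_measurable (M \<Otimes>\<^sub>M M)"
    and kernel_nonneg: "0 \<le> A p w"
    and rate_nonneg: "0 \<le> E p"
    and rate_le: "E p \<le> C"
    and bound_pos: "0 < C"
    and kernel_section: "AE p in M \<Otimes>\<^sub>M M. integrable M (A p) \<and> (LINT w|M. A p w) = E p"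
begin

definition gain :: "('a \<times> 'a \<Rightarrow> real) \<Rightarrow> 'a \<Rightarrow> real" where
  "gain h w = (LINT p|(M \<Otimes>\<^sub>M M). A p w * h p)"

text \<open>
  Adding \<open>C * f w * (LINT z|M. f z)\<close> to the loss term \<open>f w * (LINT z|M. E (w, z) * f z)\<close> with its negative sign
  gives this integral for \<open>h = tensor f f\<close>. The operator is positive since \<open>E \<le> C\<close>: encounters are topped up to the constant
  rate \<open>C\<close> by fictitious ones that leave the first partner as it is.
\<close>
definition retained :: "('a \<times> 'a \<Rightarrow> real) \<Rightarrow> 'a \<Rightarrow> real" where
  "retained h w = (LINT z|M. (C - E (w, z)) * h (w, z))"

lemma rate_mult_integrable:
  assumes "integrable (M \<Otimes>\<^sub>M M) h"
  shows "integrable (M \<Otimes>\<^sub>M M) (\<lambda>p. E p * h p)"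
  by (rule Bochner_Integration.integrable_bound[OF integrable_mult_right[OF assms, of C]])
    (use assms rate_nonneg rate_le bound_pos in \<open>auto simp: abs_mult intro!: mult_right_mono\<close>)

lemma
  assumes h: "integrable (M \<Otimes>\<^sub>M M) h"
  shows integrable_gain: "integrable M (gain h)"
    and AE_gain_section: "AE w in M. integrable (M \<Otimes>\<^sub>M M) (\<lambda>p. A p w * h p)"
    and integral_gain: "(LINT w|M. gain h w) = (LINT p|(M \<Otimes>\<^sub>M M). E p * h p)"
proof -
  interpret MM: pair_sigma_finite M M ..
  interpret MMM: pair_sigma_finite "M \<Otimes>\<^sub>M M" M ..
  have [measurable]: "h \<in> borel_measurable (M \<Otimes>\<^sub>M M)" using h by auto
  have i: "integrable ((M \<Otimes>\<^sub>M M) \<Otimes>\<^sub>M M) (\<lambda>(p, w). A p w * h p)"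
  proof (rule MMM.Fubini_integrable)
    have eq: "AE p in M \<Otimes>\<^sub>M M. (LINT w|M. norm (case (p, w) of (p, w) \<Rightarrow> A p w * h p)) = E p * \<bar>h p\<bar>"
      using kernel_section by eventually_elim (simp add: abs_mult kernel_nonneg)
    show "integrable (M \<Otimes>\<^sub>M M) (\<lambda>p. LINT w|M. norm (case (p, w) of (p, w) \<Rightarrow> A p w * h p))"
      by (subst integrable_cong_AE[OF _ _ eq]) (use rate_mult_integrable[of "\<lambda>p. \<bar>h p\<bar>"] h in auto)
    show "AE p in M \<Otimes>\<^sub>M M. integrable M (\<lambda>w. case (p, w) of (p, w) \<Rightarrow> A p w * h p)"
      using kernel_section by eventually_elim auto
  qed measurable
  show "integrable M (gain h)"
    using MMM.integrable_snd[OF i] by (simp add: gain_def[abs_def])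
  show "AE w in M. integrable (M \<Otimes>\<^sub>M M) (\<lambda>p. A p w * h p)"
    by (rule MMM.AE_integrable_snd[OF i])
  have "(LINT w|M. gain h w) = (LINT p|(M \<Otimes>\<^sub>M M). LINT w|M. A p w * h p)"
    using MMM.integral_snd[OF i] MMM.integral_fst[OF i] by (simp add: gain_def)
  also have "\<dots> = (LINT p|(M \<Otimes>\<^sub>M M). E p * h p)"
  proof (rule integral_cong_AE)
    show "AE p in M \<Otimes>\<^sub>M M. (LINT w|M. A p w * h p) = E p * h p"
      using kernel_section by eventually_elim simp
  qed measurable
  finally show "(LINT w|M. gain h w) = (LINT p|(M \<Otimes>\<^sub>M M). E p * h p)" .
qed

lemma
  assumes h: "integrable (M \<Otimes>\<^sub>M M) h"
  shows integrable_retained: "integrable M (retained h)"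
    and AE_retained_section: "AE w in M. integrable M (\<lambda>z. (C - E (w, z)) * h (w, z))"
    and integral_retained: "(LINT w|M. retained h w) = (LINT p|(M \<Otimes>\<^sub>M M). (C - E p) * h p)"
proof -
  interpret MM: pair_sigma_finite M M ..
  have i: "integrable (M \<Otimes>\<^sub>M M) (\<lambda>p. (C - E p) * h p)"
    using h rate_mult_integrable[OF h] by (simp add: left_diff_distrib)
  show "integrable M (retained h)"
    using MM.integrable_fst'[OF i] by (simp add: retained_def[abs_def])
  show "AE w in M. integrable M (\<lambda>z. (C - E (w, z)) * h (w, z))"
    using MM.AE_integrable_fst'[OF i] by simp
  show "(LINT w|M. retained h w) = (LINT p|(M \<Otimes>\<^sub>M M). (C - E p) * h p)"
    using MM.integral_fst'[OF i] by (simp add: retained_def[abs_def])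
qed

lemma integral_gain_retained:
  assumes h: "integrable (M \<Otimes>\<^sub>M M) h"
  shows "(LINT w|M. gain h w + retained h w) = C * (LINT p|(M \<Otimes>\<^sub>M M). h p)"
proof -
  have "(LINT w|M. gain h w + retained h w)
      = (LINT p|(M \<Otimes>\<^sub>M M). E p * h p) + (LINT p|(M \<Otimes>\<^sub>M M). (C - E p) * h p)"
    using integrable_gain[OF h] integrable_retained[OF h] integral_gain[OF h] integral_retained[OF h] by simp
  then show ?thesis using rate_mult_integrable[OF h] h by (simp add: left_diff_distrib)
qed

text \<open>
  Gain and retained part are positive operators, so the norm bound follows from the mass identity applied to
  \<open>\<lambda>p. \<bar>h p\<bar>\<close>; and in the mass identity the weights \<open>E\<close> and \<open>C - E\<close> add up to \<open>C\<close>.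
\<close>
sublocale collision_operator M "\<lambda>h w. gain h w + retained h w" C
proof
  show "0 < C" by (rule bound_pos)
next
  fix h :: "'a \<times> 'a \<Rightarrow> real" assume h: "integrable (M \<Otimes>\<^sub>M M) h"
  show "integrable M (\<lambda>w. gain h w + retained h w)"
    using integrable_gain[OF h] integrable_retained[OF h] by auto
  show "(LINT w|M. gain h w + retained h w) = C * (LINT p|(M \<Otimes>\<^sub>M M). h p)"
    by (rule integral_gain_retained[OF h])
  let ?a = "\<lambda>p. \<bar>h p\<bar>"
  have a: "integrable (M \<Otimes>\<^sub>M M) ?a" using h by auto
  have "L1_norm M (\<lambda>w. gain h w + retained h w) \<le> (LINT w|M. gain ?a w + retained ?a w)"
    unfolding L1_norm_def
  proof (rule integral_mono)
    show "integrable M (\<lambda>w. \<bar>gain h w + retained h w\<bar>)" "integrable M (\<lambda>w. gain ?a w + retained ?a w)"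
      using integrable_gain integrable_retained h a by auto
    fix w
    have "\<bar>gain h w\<bar> \<le> gain ?a w"
      unfolding gain_def using integral_abs_bound[of "M \<Otimes>\<^sub>M M" "\<lambda>p. A p w * h p"]
      by (simp add: abs_mult kernel_nonneg)
    moreover have "\<bar>retained h w\<bar> \<le> retained ?a w"
      unfolding retained_def using integral_abs_bound[of M "\<lambda>z. (C - E (w, z)) * h (w, z)"]
      by (simp add: abs_mult rate_le)
    ultimately show "\<bar>gain h w + retained h w\<bar> \<le> gain ?a w + retained ?a w" by linarith
  qed
  then show "L1_norm M (\<lambda>w. gain h w + retained h w) \<le> C * L1_norm (M \<Otimes>\<^sub>M M) h"
    using integral_gain_retained[OF a] by (simp add: L1_norm_def)
  show "AE w in M. gain (\<lambda>p. c * h p) w + retained (\<lambda>p. c * h p) w = c * (gain h w + retained h w)" for c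
    by (simp add: gain_def retained_def mult.left_commute[of _ c] distrib_left)
  fix h' :: "'a \<times> 'a \<Rightarrow> real" assume h': "integrable (M \<Otimes>\<^sub>M M) h'"
  show "AE w in M. gain (\<lambda>p. h p + h' p) w + retained (\<lambda>p. h p + h' p) w
      = gain h w + retained h w + (gain h' w + retained h' w)"
    using AE_gain_section[OF h] AE_gain_section[OF h'] AE_retained_section[OF h] AE_retained_section[OF h']
    by eventually_elim (simp add: gain_def retained_def distrib_left)
qed

lemma rate_section_integrable:
  assumes f: "integrable M f" and w: "w \<in> space M"
  shows "integrable M (\<lambda>z. E (w, z) * f z)"
proof (rule Bochner_Integration.integrable_bound[OF integrable_mult_right[OF f, of C]])
  have [measurable]: "f \<in> borel_measurable M" using f by auto
  show "(\<lambda>z. E (w, z) * f z) \<in> borel_measurable M" using w by measurable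
qed (use rate_nonneg rate_le bound_pos in \<open>auto simp: abs_mult intro!: mult_right_mono\<close>)

lemma collision_rhs_eq:
  assumes f: "integrable M f" and w: "w \<in> space M"
  shows "collision_rhs f w = gain (tensor f f) w - f w * (LINT z|M. E (w, z) * f z)"
proof -
  have "retained (tensor f f) w = (LINT z|M. f w * (C * f z) - f w * (E (w, z) * f z))"
    unfolding retained_def tensor_def by (simp add: algebra_simps)
  also have "\<dots> = f w * (C * (LINT z|M. f z)) - f w * (LINT z|M. E (w, z) * f z)"
    using f rate_section_integrable[OF f w] by simp
  finally show ?thesis by (simp add: collision_rhs_def algebra_simps)
qed

end

section \<open>Almost everywhere statements for Lebesgue measure\<close>

lemma sigma_finite_completion:
  assumes "sigma_finite_measure M"
  shows "sigma_finite_measure (completion M)"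
proof -
  interpret sigma_finite_measure M by fact
  obtain A where "countable A" "A \<subseteq> sets M" "\<Union>A = space M" "\<forall>a\<in>A. emeasure M a \<noteq> \<infinity>"
    using sigma_finite_countable by blast
  then show ?thesis
    by (intro sigma_finite_measure.intro exI[of _ A]) (auto simp: subset_iff)
qed

text \<open>
  Sections of functions that are measurable for Lebesgue measure on a product are measurable only almost everywhere.
  Completeness makes this harmless: integrals with respect to a complete measure depend on the integrand only up to null
  sets, whether or not it is measurable.
\<close>
lemma borel_measurable_completion_AE:
  fixes f g :: "'a \<Rightarrow> real"
  assumes f: "f \<in> borel_measurable (completion M)" and ae: "AE x in completion M. f x = g x"
  shows "g \<in> borel_measurable (completion M)"
proof (rule measurableI)
  fix B :: "real set" assume B: "B \<in> sets borel"
  show "g -` B \<inter> space (completion M) \<in> sets (completion M)"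
  proof (rule completion.in_sets_AE)
    show "f -` B \<inter> space (completion M) \<in> sets (completion M)" using measurable_sets[OF f B] .
    show "AE x in completion M. x \<in> f -` B \<inter> space (completion M) \<longleftrightarrow> x \<in> g -` B \<inter> space (completion M)"
      using ae by eventually_elim auto
  qed auto
qed simp

lemma integrable_completion_AE:
  fixes f g :: "'a \<Rightarrow> real"
  assumes f: "integrable (completion M) f" and ae: "AE x in completion M. f x = g x"
  shows "integrable (completion M) g"
proof -
  have "g \<in> borel_measurable (completion M)"
    by (rule borel_measurable_completion_AE[OF _ ae]) (use f in auto)
  with f ae show ?thesis by (subst integrable_cong_AE[symmetric, where f = f]) auto
qed

lemma integral_completion_cong_AE:
  fixes f g :: "'a \<Rightarrow> real"
  assumes ae: "AE x in completion M. f x = g x"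
  shows "integral\<^sup>L (completion M) f = integral\<^sup>L (completion M) g"
proof (cases "integrable (completion M) f")
  case True
  then have "integrable (completion M) g" using ae by (rule integrable_completion_AE)
  with True ae show ?thesis by (intro integral_cong_AE) auto
next
  case False
  moreover have "\<not> integrable (completion M) g"
  proof
    assume g: "integrable (completion M) g"
    have "AE x in completion M. g x = f x" using ae by eventually_elim simp
    from integrable_completion_AE[OF g this] False show False by contradiction
  qed
  ultimately show ?thesis by (simp add: not_integrable_integral_eq)
qed

lemma AE_lebesgue_on_iff:
  "S \<in> sets borel \<Longrightarrow> (AE x in lebesgue_on S. R x) \<longleftrightarrow> (AE x in lebesgue. x \<in> S \<longrightarrow> R x)"
  by (rule AE_restrict_space_iff) auto

lemma set_integral_lebesgue_cong_AE:
  fixes f g :: "'a::euclidean_space \<Rightarrow> real"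
  assumes "S \<in> sets borel" "AE x in lebesgue_on S. f x = g x"
  shows "(LINT x:S|lebesgue. f x) = (LINT x:S|lebesgue. g x)"
  unfolding set_lebesgue_integral_def
  by (rule integral_completion_cong_AE)
    (use assms(2) in \<open>auto simp: AE_lebesgue_on_iff[OF assms(1)] indicator_def\<close>)

lemma set_integrable_lebesgue_cong_AE:
  fixes f g :: "'a::euclidean_space \<Rightarrow> real"
  assumes "S \<in> sets borel" "AE x in lebesgue_on S. f x = g x" "set_integrable lebesgue S f"
  shows "set_integrable lebesgue S g"
  using assms(3) unfolding set_integrable_def
  by (rule integrable_completion_AE)
    (use assms(2) in \<open>auto simp: AE_lebesgue_on_iff[OF assms(1)] indicator_def\<close>)

lemma lebesgue_on_ex_borel_version:
  fixes f :: "'a::euclidean_space \<Rightarrow> real"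
  assumes "S \<in> sets lebesgue" "f \<in> borel_measurable (lebesgue_on S)"
  obtains g where "g \<in> borel_measurable borel" "AE x in lborel. x \<in> S \<longrightarrow> f x = g x"
proof -
  have "(\<lambda>x. if x \<in> S then f x else 0) \<in> borel_measurable lebesgue"
    using assms by (simp add: borel_measurable_if)
  then obtain g where g: "g \<in> borel_measurable lborel" "AE x in lborel. (if x \<in> S then f x else 0) = g x"
    using completion_ex_borel_measurable_real by blast
  then have "AE x in lborel. x \<in> S \<longrightarrow> f x = g x"
    by (auto elim: eventually_mono)
  with g(1) show thesis by (intro that[of g]) auto
qed

lemma AE_lborel_pair_sections:
  fixes R :: "'a::euclidean_space \<Rightarrow> 'b::euclidean_space \<Rightarrow> bool"
  assumes ae: "AE p in lborel. p \<in> S1 \<times> S2 \<longrightarrow> R (fst p) (snd p)"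
    and S: "S1 \<in> sets borel" "S2 \<in> sets borel"
  shows "AE x in lebesgue_on S1. AE y in lebesgue_on S2. R x y"
proof -
  have "AE p in lborel \<Otimes>\<^sub>M lborel. p \<in> S1 \<times> S2 \<longrightarrow> R (fst p) (snd p)"
    using ae unfolding lborel_prod .
  from lborel_pair.AE_pair[OF this]
  have "AE x in lebesgue. AE y in lborel. x \<in> S1 \<and> y \<in> S2 \<longrightarrow> R x y"
    by (intro AE_completion) simp
  then show ?thesis
    unfolding AE_lebesgue_on_iff[OF S(1)] AE_lebesgue_on_iff[OF S(2)]
    by eventually_elim (auto intro: AE_completion)
qed

text \<open>
  The integral of the indicator of a Borel null set may be computed in any order of the three variables.
\<close>
lemma AE_lborel_rotate3:
  fixes R :: "'a::euclidean_space \<Rightarrow> 'b::euclidean_space \<Rightarrow> 'c::euclidean_space \<Rightarrow> bool"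
  assumes "AE (x, y, u) in lborel. R x y u"
  shows "AE (u, x, y) in lborel. R x y u"
proof -
  obtain N where N: "{p \<in> space lborel. \<not> (case p of (x, y, u) \<Rightarrow> R x y u)} \<subseteq> N"
      "emeasure lborel N = 0" "N \<in> sets lborel"
    using assms unfolding eventually_ae_filter by (auto simp: null_sets_def)
  have [measurable]: "N \<in> sets (lborel \<Otimes>\<^sub>M (lborel \<Otimes>\<^sub>M lborel))" using N(3) by (simp only: lborel_prod)
  let ?f = "\<lambda>x y u. indicator N (x, y, u) :: ennreal"
  have "(\<integral>\<^sup>+u. \<integral>\<^sup>+x. \<integral>\<^sup>+y. ?f x y u \<partial>lborel \<partial>lborel \<partial>lborel)
      = (\<integral>\<^sup>+x. \<integral>\<^sup>+u. \<integral>\<^sup>+y. ?f x y u \<partial>lborel \<partial>lborel \<partial>lborel)"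
    by (rule lborel_pair.Fubini') measurable
  also have "\<dots> = (\<integral>\<^sup>+x. \<integral>\<^sup>+y. \<integral>\<^sup>+u. ?f x y u \<partial>lborel \<partial>lborel \<partial>lborel)"
    by (intro nn_integral_cong lborel_pair.Fubini') measurable
  also have "\<dots> = (\<integral>\<^sup>+x. \<integral>\<^sup>+q. indicator N (x, q) \<partial>(lborel \<Otimes>\<^sub>M lborel) \<partial>lborel)"
    by (intro nn_integral_cong lborel.nn_integral_fst) measurable
  also have "\<dots> = (\<integral>\<^sup>+p. indicator N p \<partial>(lborel \<Otimes>\<^sub>M lborel))"
  proof -
    have "indicator N \<in> borel_measurable (lborel \<Otimes>\<^sub>M lborel)"
      using N(3) by (simp only: lborel_prod) (rule borel_measurable_indicator)
    from lborel.nn_integral_fst[OF this] show ?thesis by (simp only: lborel_prod)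
  qed
  also have "\<dots> = 0" unfolding lborel_prod using N by simp
  finally have z: "(\<integral>\<^sup>+u. \<integral>\<^sup>+x. \<integral>\<^sup>+y. ?f x y u \<partial>lborel \<partial>lborel \<partial>lborel) = 0" .
  have m2: "(\<lambda>(u, x, y). ?f x y u) \<in> borel_measurable (lborel \<Otimes>\<^sub>M (lborel \<Otimes>\<^sub>M lborel))" by measurable
  have "(\<integral>\<^sup>+p. (case p of (u, x, y) \<Rightarrow> ?f x y u) \<partial>lborel) = (\<integral>\<^sup>+u. \<integral>\<^sup>+q. (case q of (x, y) \<Rightarrow> ?f x y u) \<partial>lborel \<partial>lborel)"
  proof -
    have "(\<lambda>(u, x, y). ?f x y u) \<in> borel_measurable (lborel \<Otimes>\<^sub>M lborel)" using m2 by (simp only: lborel_prod)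
    from lborel.nn_integral_fst[OF this] show ?thesis by (simp only: lborel_prod split_conv)
  qed
  also have "\<dots> = (\<integral>\<^sup>+u. \<integral>\<^sup>+x. \<integral>\<^sup>+y. ?f x y u \<partial>lborel \<partial>lborel \<partial>lborel)"
  proof (rule nn_integral_cong)
    fix u :: 'c
    have "(\<lambda>(x, y). ?f x y u) \<in> borel_measurable (lborel \<Otimes>\<^sub>M lborel)" by measurable
    from lborel.nn_integral_fst[OF this]
    show "(\<integral>\<^sup>+q. (case q of (x, y) \<Rightarrow> ?f x y u) \<partial>lborel) = (\<integral>\<^sup>+x. \<integral>\<^sup>+y. ?f x y u \<partial>lborel \<partial>lborel)"
      by (simp only: lborel_prod split_conv)
  qed
  finally have "(\<integral>\<^sup>+p. (case p of (u, x, y) \<Rightarrow> ?f x y u) \<partial>lborel) = 0" using z by simp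
  then have "AE p in lborel. (case p of (u, x, y) \<Rightarrow> ?f x y u) = 0"
  proof (subst nn_integral_0_iff_AE[symmetric])
    show "(\<lambda>p. case p of (u, x, y) \<Rightarrow> ?f x y u) \<in> borel_measurable lborel" using m2 by (simp only: lborel_prod)
  qed
  moreover have "R x y u" if "(x, y, u) \<notin> N" for x y u
    using subsetD[OF N(1), of "(x, y, u)"] that by auto
  ultimately show ?thesis
    by (auto elim!: eventually_mono simp: indicator_def split: if_splits)
qed

text \<open>
  In the first order the exceptional null sets concern the outcome \<open>u\<close> of a fixed encounter, as in the normalisation of
  the transition rates; in the second they concern the encounters with a fixed outcome \<open>u\<close>, as in the gain term.
\<close>
lemma AE_lborel_triple_sections:
  fixes R :: "'a::euclidean_space \<Rightarrow> 'b::euclidean_space \<Rightarrow> 'c::euclidean_space \<Rightarrow> bool"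
  assumes ae: "AE (x, y, u) in lborel. x \<in> S1 \<and> y \<in> S2 \<and> u \<in> S3 \<longrightarrow> R x y u"
    and S: "S1 \<in> sets borel" "S2 \<in> sets borel" "S3 \<in> sets borel"
  shows "AE x in lebesgue_on S1. AE y in lebesgue_on S2. AE u in lebesgue_on S3. R x y u"
    and "AE u in lebesgue_on S3. AE x in lebesgue_on S1. AE y in lebesgue_on S2. R x y u"
proof -
  have *: "AE x in lebesgue_on S1. AE y in lebesgue_on S2. AE u in lebesgue_on S3. R x y u"
    if ae: "AE (x, y, u) in lborel. x \<in> S1 \<and> y \<in> S2 \<and> u \<in> S3 \<longrightarrow> R x y u"
    and S: "S1 \<in> sets borel" "S2 \<in> sets borel" "S3 \<in> sets borel"
    for R :: "'p::euclidean_space \<Rightarrow> 'q::euclidean_space \<Rightarrow> 'r::euclidean_space \<Rightarrow> bool" and S1 S2 S3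
  proof -
    have "AE x in lebesgue_on S1. AE q in lebesgue_on (S2 \<times> S3). R x (fst q) (snd q)"
    proof (rule AE_lborel_pair_sections)
      show "AE p in lborel. p \<in> S1 \<times> (S2 \<times> S3) \<longrightarrow> R (fst p) (fst (snd p)) (snd (snd p))"
        using ae by (auto elim!: eventually_mono)
    qed (use S in \<open>auto intro: borel_Times\<close>)
    then show ?thesis
    proof eventually_elim
      case (elim x)
      have "AE q in lebesgue. q \<in> S2 \<times> S3 \<longrightarrow> R x (fst q) (snd q)"
        using elim unfolding AE_lebesgue_on_iff[OF borel_Times[OF S(2,3)]] .
      then have "AE q in lborel. q \<in> S2 \<times> S3 \<longrightarrow> R x (fst q) (snd q)"
        by (simp only: AE_completion_iff)
      then show ?case using S by (intro AE_lborel_pair_sections)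
    qed
  qed
  show "AE x in lebesgue_on S1. AE y in lebesgue_on S2. AE u in lebesgue_on S3. R x y u"
    by (rule *[OF ae S])
  have "AE (u, x, y) in lborel. u \<in> S3 \<and> x \<in> S1 \<and> y \<in> S2 \<longrightarrow> R x y u"
    using AE_lborel_rotate3[OF ae] by (auto elim!: eventually_mono)
  from *[OF this S(3,1,2)]
  show "AE u in lebesgue_on S3. AE x in lebesgue_on S1. AE y in lebesgue_on S2. R x y u" .
qed

section \<open>The phase space of several subsystems\<close>

text \<open>
  The disjoint union of the microstate domains. A family \<open>g 1, \<dots>, g n\<close> of densities is a single function
  \<open>case_prod g\<close> on it, \<open>X_norm\<close> is the \<open>L\<^sup>1\<close> norm, and the double sum over subsystems together with the double integral
  over their microstates is one integral over pairs of points.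
\<close>
definition phase_space :: "nat \<Rightarrow> (nat \<Rightarrow> real set) \<Rightarrow> (nat \<times> real) measure" where
  "phase_space n D = restrict_space (count_space {1..n} \<Otimes>\<^sub>M lebesgue) (SIGMA i:{1..n}. D i)"

locale microstates =
  fixes n :: nat and D :: "nat \<Rightarrow> real set"
  assumes D_borel: "i \<in> {1..n} \<Longrightarrow> D i \<in> sets borel"
begin

abbreviation "all_states \<equiv> (SIGMA i:{1..n}. D i)"

lemma sigma_finite_lebesgue: "sigma_finite_measure (lebesgue :: real measure)"
  by (rule sigma_finite_completion) (rule sigma_finite_lborel)

lemma pair_sigma_finite_count_lebesgue:
  "pair_sigma_finite (count_space {1..n}) (lebesgue :: real measure)"
  by (simp add: pair_sigma_finite_def sigma_finite_lebesgue sigma_finite_measure_count_space_finite)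

lemma all_states_measurable: "all_states \<in> sets (count_space {1..n} \<Otimes>\<^sub>M lebesgue)"
proof -
  have "all_states = (\<Union>i\<in>{1..n}. {i} \<times> D i)" by auto
  also have "\<dots> \<in> sets (count_space {1..n} \<Otimes>\<^sub>M lebesgue)"
    using D_borel by (intro sets.finite_UN pair_measureI) auto
  finally show ?thesis .
qed

lemma all_states_Int: "all_states \<inter> space (count_space {1..n} \<Otimes>\<^sub>M lebesgue) \<in> sets (count_space {1..n} \<Otimes>\<^sub>M lebesgue)"
  by (rule sets.Int[OF all_states_measurable sets.top])

lemma space_phase_space: "space (phase_space n D) = all_states"
  by (auto simp: phase_space_def space_restrict_space space_pair_measure)

sublocale sigma_finite_measure "phase_space n D"
proof -
  interpret pair_sigma_finite "count_space {1..n}" "lebesgue :: real measure"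
    by (rule pair_sigma_finite_count_lebesgue)
  show "sigma_finite_measure (phase_space n D)"
    unfolding phase_space_def
    by (rule sigma_finite_measure_restrict_space[OF _ all_states_measurable]) unfold_locales
qed

lemma fst_measurable_phase_space: "fst \<in> measurable (phase_space n D) (count_space {1..n})"
  unfolding phase_space_def by (rule measurable_restrict_space1) (rule measurable_fst)

lemma snd_measurable_phase_space: "snd \<in> borel_measurable (phase_space n D)"
proof -
  have "snd \<in> measurable (phase_space n D) (lebesgue :: real measure)"
    unfolding phase_space_def by (rule measurable_restrict_space1) (rule measurable_snd)
  moreover have "(\<lambda>x. x) \<in> borel_measurable (lebesgue :: real measure)"
    by (rule measurable_completion) simp
  ultimately show ?thesis by (rule measurable_compose)
qed

lemma AE_phase_space_iff:
  "(AE z in phase_space n D. R z) \<longleftrightarrow> (\<forall>i\<in>{1..n}. AE u in lebesgue_on (D i). R (i, u))"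
proof -
  interpret pair_sigma_finite "count_space {1..n}" "lebesgue :: real measure"
    by (rule pair_sigma_finite_count_lebesgue)
  have "(AE z in phase_space n D. R z)
      \<longleftrightarrow> (AE z in count_space {1..n} \<Otimes>\<^sub>M lebesgue. z \<in> all_states \<longrightarrow> R z)"
    unfolding phase_space_def by (rule AE_restrict_space_iff[OF all_states_Int])
  also have "\<dots> \<longleftrightarrow> (\<forall>i\<in>{1..n}. AE u in lebesgue. u \<in> D i \<longrightarrow> R (i, u))"
  proof
    assume "AE z in count_space {1..n} \<Otimes>\<^sub>M lebesgue. z \<in> all_states \<longrightarrow> R z"
    from AE_pair[OF this] show "\<forall>i\<in>{1..n}. AE u in lebesgue. u \<in> D i \<longrightarrow> R (i, u)"
      by (auto simp: AE_count_space)
  next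
    assume ae: "\<forall>i\<in>{1..n}. AE u in lebesgue. u \<in> D i \<longrightarrow> R (i, u)"
    \<comment> \<open>\<open>R\<close> is arbitrary; its exceptional sets are measurable because Lebesgue measure is complete.\<close>
    let ?B = "\<lambda>i. {u. \<not> (u \<in> D i \<longrightarrow> R (i, u))}"
    have B: "?B i \<in> null_sets lebesgue" if "i \<in> {1..n}" for i
      using ae that by (simp add: completion.AE_iff_null_sets)
    have meas: "{z \<in> space (count_space {1..n} \<Otimes>\<^sub>M lebesgue). z \<in> all_states \<longrightarrow> R z}
        = space (count_space {1..n} \<Otimes>\<^sub>M lebesgue) - (\<Union>i\<in>{1..n}. {i} \<times> ?B i)"
      by (auto simp: space_pair_measure)
    show "AE z in count_space {1..n} \<Otimes>\<^sub>M lebesgue. z \<in> all_states \<longrightarrow> R z"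
    proof (rule AE_pair_measure)
      show "{z \<in> space (count_space {1..n} \<Otimes>\<^sub>M lebesgue). z \<in> all_states \<longrightarrow> R z}
          \<in> sets (count_space {1..n} \<Otimes>\<^sub>M lebesgue)"
        unfolding meas using B by (intro sets.Diff sets.top sets.finite_UN pair_measureI) auto
      show "AE i in count_space {1..n}. AE u in lebesgue. (i, u) \<in> all_states \<longrightarrow> R (i, u)"
        using ae by (simp add: AE_count_space)
    qed
  qed
  also have "\<dots> \<longleftrightarrow> (\<forall>i\<in>{1..n}. AE u in lebesgue_on (D i). R (i, u))"
    using D_borel by (simp add: AE_lebesgue_on_iff)
  finally show ?thesis .
qed

lemma
  fixes f :: "nat \<times> real \<Rightarrow> real"
  shows integrable_phase_space_iff:
      "integrable (phase_space n D) f \<longleftrightarrow> (\<forall>i\<in>{1..n}. set_integrable lebesgue (D i) (\<lambda>u. f (i, u)))"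
    and integral_phase_space:
      "integrable (phase_space n D) f \<Longrightarrow>
        (LINT z|phase_space n D. f z) = (\<Sum>i\<in>{1..n}. LINT u:D i|lebesgue. f (i, u))"
proof -
  interpret pair_sigma_finite "count_space {1..n}" "lebesgue :: real measure"
    by (rule pair_sigma_finite_count_lebesgue)
  let ?N = "count_space {1..n} \<Otimes>\<^sub>M (lebesgue :: real measure)"
  let ?g = "\<lambda>z. indicator all_states z *\<^sub>R f z"
  have g: "?g (i, u) = indicator (D i) u *\<^sub>R f (i, u)" if "i \<in> {1..n}" for i u
    using that by (simp add: indicator_def)
  have iff: "integrable (phase_space n D) f \<longleftrightarrow> integrable ?N ?g"
    unfolding phase_space_def by (rule integrable_restrict_space[OF all_states_Int])
  show *: "integrable (phase_space n D) f \<longleftrightarrow> (\<forall>i\<in>{1..n}. set_integrable lebesgue (D i) (\<lambda>u. f (i, u)))"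
    unfolding iff
  proof
    assume "integrable ?N ?g"
    from AE_integrable_fst'[OF this]
    have "\<forall>i\<in>{1..n}. integrable lebesgue (\<lambda>u. ?g (i, u))" by (simp only: AE_count_space)
    then show "\<forall>i\<in>{1..n}. set_integrable lebesgue (D i) (\<lambda>u. f (i, u))"
      unfolding set_integrable_def by (intro ballI) (drule bspec, assumption, simp only: g)
  next
    assume "\<forall>i\<in>{1..n}. set_integrable lebesgue (D i) (\<lambda>u. f (i, u))"
    then have i: "integrable lebesgue (\<lambda>u. ?g (i, u))" if "i \<in> {1..n}" for i
      using that unfolding set_integrable_def by (simp only: g)
    show "integrable ?N ?g"
    proof (rule Fubini_integrable)
      show "?g \<in> borel_measurable ?N"
        by (rule measurable_pair_measure_countable1) (use i in \<open>auto intro: borel_measurable_integrable\<close>)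
      show "integrable (count_space {1..n}) (\<lambda>x. LINT y|lebesgue. norm (?g (x, y)))"
        by (rule integrable_count_space) simp
      show "AE x in count_space {1..n}. integrable lebesgue (\<lambda>y. ?g (x, y))"
        unfolding AE_count_space using i by blast
    qed
  qed
  assume "integrable (phase_space n D) f"
  then have i: "integrable ?N ?g" by (simp only: iff)
  have "(LINT z|phase_space n D. f z) = (LINT z|?N. ?g z)"
    unfolding phase_space_def by (rule integral_restrict_space[OF all_states_Int])
  also have "\<dots> = (LINT i|count_space {1..n}. LINT u|lebesgue. ?g (i, u))"
    by (rule integral_fst'[OF i, symmetric])
  also have "\<dots> = (\<Sum>i\<in>{1..n}. LINT u|lebesgue. ?g (i, u))"
    by (rule lebesgue_integral_count_space_finite) simp
  finally show "(LINT z|phase_space n D. f z) = (\<Sum>i\<in>{1..n}. LINT u:D i|lebesgue. f (i, u))"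
    unfolding set_lebesgue_integral_def by (simp only: g cong: sum.cong)
qed

lemma integrable_phase_space_cong_AE:
  fixes f g :: "nat \<times> real \<Rightarrow> real"
  assumes "integrable (phase_space n D) f" "AE z in phase_space n D. f z = g z"
  shows "integrable (phase_space n D) g"
  unfolding integrable_phase_space_iff
proof
  fix i assume i: "i \<in> {1..n}"
  show "set_integrable lebesgue (D i) (\<lambda>u. g (i, u))"
    by (rule set_integrable_lebesgue_cong_AE[OF D_borel[OF i], of "\<lambda>u. f (i, u)"])
      (use assms i in \<open>simp_all add: integrable_phase_space_iff AE_phase_space_iff\<close>)
qed

text \<open>
  Fubini's theorem gives integrability of the inner integral over the whole phase space only. Cutting \<open>F\<close> off to one
  subsystem \<open>k\<close> of the second partner yields it for each summand separately.
\<close>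
lemma integral_phase_space_pair:
  fixes F :: "(nat \<times> real) \<times> (nat \<times> real) \<Rightarrow> real"
  assumes F: "integrable (phase_space n D \<Otimes>\<^sub>M phase_space n D) F"
  shows "(LINT p|(phase_space n D \<Otimes>\<^sub>M phase_space n D). F p)
      = (\<Sum>h\<in>{1..n}. \<Sum>k\<in>{1..n}. LINT x:D h|lebesgue. LINT y:D k|lebesgue. F ((h, x), (k, y)))"
proof -
  let ?M = "phase_space n D"
  interpret MM: pair_sigma_finite ?M ?M ..
  define G where "G k p = (if fst (snd p) = k then 1 else 0) * F p" for k p
  have iG: "integrable (?M \<Otimes>\<^sub>M ?M) (G k)" for k
  proof (rule Bochner_Integration.integrable_bound[OF F])
    have "(\<lambda>p. fst (snd p)) \<in> measurable (?M \<Otimes>\<^sub>M ?M) (count_space {1..n})"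
      by (rule measurable_compose[OF measurable_snd fst_measurable_phase_space])
    then have "(\<lambda>p. (if fst (snd p) = k then 1 else 0) :: real) \<in> borel_measurable (?M \<Otimes>\<^sub>M ?M)"
      by (rule measurable_compose) simp
    then show "G k \<in> borel_measurable (?M \<Otimes>\<^sub>M ?M)"
      unfolding G_def[abs_def] using F by (intro borel_measurable_times) auto
  qed (auto simp: G_def)
  have one: "(LINT p|(?M \<Otimes>\<^sub>M ?M). G k p)
      = (\<Sum>h\<in>{1..n}. LINT x:D h|lebesgue. LINT y:D k|lebesgue. F ((h, x), (k, y)))" if k: "k \<in> {1..n}" for k
  proof -
    have "(LINT p|(?M \<Otimes>\<^sub>M ?M). G k p) = (LINT z|?M. LINT z'|?M. G k (z, z'))"
      by (rule MM.integral_fst'[OF iG, symmetric])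
    also have "\<dots> = (\<Sum>h\<in>{1..n}. LINT x:D h|lebesgue. LINT z'|?M. G k ((h, x), z'))"
      by (rule integral_phase_space[OF MM.integrable_fst'[OF iG]])
    also have "\<dots> = (\<Sum>h\<in>{1..n}. LINT x:D h|lebesgue. LINT y:D k|lebesgue. F ((h, x), (k, y)))"
    proof (intro sum.cong refl set_integral_lebesgue_cong_AE D_borel)
      fix h assume h: "h \<in> {1..n}"
      have "AE x in lebesgue_on (D h). integrable ?M (\<lambda>z'. G k ((h, x), z'))"
        using MM.AE_integrable_fst'[OF iG] h by (simp add: AE_phase_space_iff)
      then show "AE x in lebesgue_on (D h). (LINT z'|?M. G k ((h, x), z')) = (LINT y:D k|lebesgue. F ((h, x), (k, y)))"
      proof eventually_elim
        case (elim x)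
        have "(LINT z'|?M. G k ((h, x), z')) = (\<Sum>k'\<in>{1..n}. LINT y:D k'|lebesgue. G k ((h, x), (k', y)))"
          by (rule integral_phase_space[OF elim])
        also have "\<dots> = (\<Sum>k'\<in>{1..n}. if k' = k then LINT y:D k|lebesgue. F ((h, x), (k, y)) else 0)"
          by (intro sum.cong) (auto simp: G_def)
        finally show ?case using k by simp
      qed
    qed
    finally show ?thesis .
  qed
  have "(LINT p|(?M \<Otimes>\<^sub>M ?M). F p) = (LINT p|(?M \<Otimes>\<^sub>M ?M). (\<Sum>k\<in>{1..n}. G k p))"
  proof (rule Bochner_Integration.integral_cong[OF refl])
    fix p assume "p \<in> space (?M \<Otimes>\<^sub>M ?M)"
    then have "fst (snd p) \<in> {1..n}" by (auto simp: space_pair_measure space_phase_space)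
    then show "F p = (\<Sum>k\<in>{1..n}. G k p)"
      unfolding G_def sum_distrib_right[symmetric] by (simp add: sum.delta)
  qed
  also have "\<dots> = (\<Sum>k\<in>{1..n}. LINT p|(?M \<Otimes>\<^sub>M ?M). G k p)"
    by (rule Bochner_Integration.integral_sum) (rule iG)
  also have "\<dots> = (\<Sum>k\<in>{1..n}. \<Sum>h\<in>{1..n}. LINT x:D h|lebesgue. LINT y:D k|lebesgue. F ((h, x), (k, y)))"
    by (rule sum.cong[OF refl one])
  also have "\<dots> = (\<Sum>h\<in>{1..n}. \<Sum>k\<in>{1..n}. LINT x:D h|lebesgue. LINT y:D k|lebesgue. F ((h, x), (k, y)))"
    by (rule sum.swap)
  finally show ?thesis .
qed

lemma X_space_iff_integrable:
  "g \<in> X_space n D \<longleftrightarrow> integrable (phase_space n D) (case_prod g)"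
  by (simp add: X_space_def integrable_phase_space_iff)

lemma X_eq_iff_AE: "X_eq n D g g' \<longleftrightarrow> (AE z in phase_space n D. case_prod g z = case_prod g' z)"
  by (simp add: X_eq_def AE_phase_space_iff)

lemma X_norm_eq_L1_norm:
  assumes "integrable (phase_space n D) (case_prod g)"
  shows "X_norm n D g = L1_norm (phase_space n D) (case_prod g)"
proof -
  have "integrable (phase_space n D) (\<lambda>z. \<bar>case_prod g z\<bar>)" using assms by (rule integrable_abs)
  from integral_phase_space[OF this] show ?thesis by (simp only: L1_norm_def X_norm_def split_conv)
qed

lemma X_has_derivative_on_iff:
  "X_has_derivative_on n D I f f' \<longleftrightarrow>
     L1_has_derivative_on (phase_space n D) I (\<lambda>t. case_prod (f t)) (\<lambda>t. case_prod (f' t))"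
proof -
  let ?M = "phase_space n D"
  have "((\<lambda>s. X_norm n D (\<lambda>i u. (f s i u - f t i u) / (s - t) - f' t i u)) \<longlongrightarrow> 0) (at t within I)
     \<longleftrightarrow> ((\<lambda>s. L1_norm ?M (\<lambda>x. (case_prod (f s) x - case_prod (f t) x) / (s - t) - case_prod (f' t) x)) \<longlongrightarrow> 0)
          (at t within I)"
    if int: "\<forall>t\<in>I. integrable ?M (case_prod (f t)) \<and> integrable ?M (case_prod (f' t))" and t: "t \<in> I" for t
  proof (rule tendsto_cong)
    show "\<forall>\<^sub>F s in at t within I. X_norm n D (\<lambda>i u. (f s i u - f t i u) / (s - t) - f' t i u)
        = L1_norm ?M (\<lambda>x. (case_prod (f s) x - case_prod (f t) x) / (s - t) - case_prod (f' t) x)"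
      unfolding eventually_at_filter
    proof (intro always_eventually allI impI)
      fix s assume s: "s \<in> I"
      have eq: "case_prod (\<lambda>i u. (f s i u - f t i u) / (s - t) - f' t i u)
          = (\<lambda>x. (case_prod (f s) x - case_prod (f t) x) / (s - t) - case_prod (f' t) x)" by auto
      have "integrable ?M (case_prod (\<lambda>i u. (f s i u - f t i u) / (s - t) - f' t i u))"
        unfolding eq using int s t
        by (intro Bochner_Integration.integrable_diff integrable_divide_zero) auto
      from X_norm_eq_L1_norm[OF this]
      show "X_norm n D (\<lambda>i u. (f s i u - f t i u) / (s - t) - f' t i u)
        = L1_norm ?M (\<lambda>x. (case_prod (f s) x - case_prod (f t) x) / (s - t) - case_prod (f' t) x)"
        by (simp only: eq)
    qed
  qed
  then show ?thesis
    unfolding X_has_derivative_on_def L1_has_derivative_on_def X_space_iff_integrable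
    by (intro conj_cong[OF refl] ball_cong refl)
qed

end

section \<open>The kinetic system\<close>

text \<open>
  The rates are Lebesgue measurable on products of domains, whereas Fubini's theorem is stated for product \<open>\<sigma>\<close>-algebras;
  it is applied to Borel functions that agree with the rates almost everywhere.
\<close>
definition borel_version :: "'a::euclidean_space set \<Rightarrow> ('a \<Rightarrow> real) \<Rightarrow> 'a \<Rightarrow> real" where
  "borel_version S f =
     (SOME g. g \<in> borel_measurable borel \<and> (AE x in lborel. x \<in> S \<longrightarrow> f x = g x))"

lemma
  assumes "S \<in> sets lebesgue" "f \<in> borel_measurable (lebesgue_on S)"
  shows borel_version_measurable: "borel_version S f \<in> borel_measurable borel"
    and AE_borel_version: "AE x in lborel. x \<in> S \<longrightarrow> f x = borel_version S f x"
proof -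
  obtain g where "g \<in> borel_measurable borel" "AE x in lborel. x \<in> S \<longrightarrow> f x = g x"
    using lebesgue_on_ex_borel_version[OF assms] .
  then have "\<exists>g. g \<in> borel_measurable borel \<and> (AE x in lborel. x \<in> S \<longrightarrow> f x = g x)" by blast
  from someI_ex[OF this, folded borel_version_def]
  show "borel_version S f \<in> borel_measurable borel"
    "AE x in lborel. x \<in> S \<longrightarrow> f x = borel_version S f x" by auto
qed

locale kinetic_system = microstates n D for n :: nat and D :: "nat \<Rightarrow> real set" +
  fixes \<eta> :: "nat \<Rightarrow> nat \<Rightarrow> real \<Rightarrow> real \<Rightarrow> real"
    and \<tau> :: "nat \<Rightarrow> nat \<Rightarrow> nat \<Rightarrow> real \<Rightarrow> real \<Rightarrow> real \<Rightarrow> real"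
    and C :: real
  assumes C_pos: "0 < C"
    and \<eta>_measurable: "h \<in> {1..n} \<Longrightarrow> k \<in> {1..n} \<Longrightarrow>
          (\<lambda>(x, y). \<eta> h k x y) \<in> borel_measurable (lebesgue_on (D h \<times> D k))"
    and \<eta>_nonneg: "h \<in> {1..n} \<Longrightarrow> k \<in> {1..n} \<Longrightarrow> x \<in> D h \<Longrightarrow> y \<in> D k \<Longrightarrow> 0 \<le> \<eta> h k x y"
    and \<eta>_le: "h \<in> {1..n} \<Longrightarrow> k \<in> {1..n} \<Longrightarrow> x \<in> D h \<Longrightarrow> y \<in> D k \<Longrightarrow> \<eta> h k x y \<le> C"
    and \<tau>_measurable: "h \<in> {1..n} \<Longrightarrow> k \<in> {1..n} \<Longrightarrow> i \<in> {1..n} \<Longrightarrow>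
          (\<lambda>(x, y, u). \<tau> h k i x y u) \<in> borel_measurable (lebesgue_on (D h \<times> D k \<times> D i))"
    and \<tau>_nonneg: "h \<in> {1..n} \<Longrightarrow> k \<in> {1..n} \<Longrightarrow> i \<in> {1..n} \<Longrightarrow>
          x \<in> D h \<Longrightarrow> y \<in> D k \<Longrightarrow> u \<in> D i \<Longrightarrow> 0 \<le> \<tau> h k i x y u"
    and \<tau>_integrable: "h \<in> {1..n} \<Longrightarrow> k \<in> {1..n} \<Longrightarrow> i \<in> {1..n} \<Longrightarrow>
          x \<in> D h \<Longrightarrow> y \<in> D k \<Longrightarrow> \<tau> h k i x y absolutely_integrable_on D i"
    and \<tau>_normalized: "h \<in> {1..n} \<Longrightarrow> k \<in> {1..n} \<Longrightarrow> x \<in> D h \<Longrightarrow> y \<in> D k \<Longrightarrow>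
          (\<Sum>i\<in>{1..n}. LINT u:D i|lebesgue. \<tau> h k i x y u) = 1"
begin

abbreviation "M \<equiv> phase_space n D"

text \<open>
  Clipping makes the bounds \<open>0 \<le> \<eta> \<le> C\<close> and \<open>0 \<le> \<tau>\<close> hold everywhere, and not only where the Borel versions agree with
  \<open>\<eta>\<close> and \<open>\<tau>\<close>.
\<close>
definition rate :: "nat \<Rightarrow> nat \<Rightarrow> real \<times> real \<Rightarrow> real" where
  "rate h k p = max 0 (min C (borel_version (D h \<times> D k) (\<lambda>(x, y). \<eta> h k x y) p))"

definition transition :: "nat \<Rightarrow> nat \<Rightarrow> nat \<Rightarrow> real \<times> real \<times> real \<Rightarrow> real" where
  "transition h k i p = max 0 (borel_version (D h \<times> D k \<times> D i) (\<lambda>(x, y, u). \<tau> h k i x y u) p)"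

definition pair_rate :: "(nat \<times> real) \<times> (nat \<times> real) \<Rightarrow> real" where
  "pair_rate p = rate (fst (fst p)) (fst (snd p)) (snd (fst p), snd (snd p))"

definition pair_kernel :: "(nat \<times> real) \<times> (nat \<times> real) \<Rightarrow> nat \<times> real \<Rightarrow> real" where
  "pair_kernel p w = pair_rate p *
     transition (fst (fst p)) (fst (snd p)) (fst w) (snd (fst p), snd (snd p), snd w)"

lemma D_prod_lebesgue:
  assumes "h \<in> {1..n}" "k \<in> {1..n}"
  shows "D h \<times> D k \<in> sets lebesgue" and "i \<in> {1..n} \<Longrightarrow> D h \<times> D k \<times> D i \<in> sets lebesgue"
  using assms by (auto intro!: sets_completionI_sets borel_Times D_borel simp del: borel_prod)

lemma rate_borel: "h \<in> {1..n} \<Longrightarrow> k \<in> {1..n} \<Longrightarrow> rate h k \<in> borel_measurable borel"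
  unfolding rate_def[abs_def]
  by (intro borel_measurable_max borel_measurable_min borel_measurable_const
      borel_version_measurable D_prod_lebesgue \<eta>_measurable)

lemma transition_borel:
  "h \<in> {1..n} \<Longrightarrow> k \<in> {1..n} \<Longrightarrow> i \<in> {1..n} \<Longrightarrow> transition h k i \<in> borel_measurable borel"
  unfolding transition_def[abs_def]
  by (intro borel_measurable_max borel_measurable_const
      borel_version_measurable D_prod_lebesgue \<tau>_measurable)

lemma AE_rate:
  assumes "h \<in> {1..n}" "k \<in> {1..n}"
  shows "AE x in lebesgue_on (D h). AE y in lebesgue_on (D k). rate h k (x, y) = \<eta> h k x y"
proof (rule AE_lborel_pair_sections)
  show "AE p in lborel. p \<in> D h \<times> D k \<longrightarrow> rate h k (fst p, snd p) = \<eta> h k (fst p) (snd p)"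
    using AE_borel_version[OF D_prod_lebesgue(1)[OF assms] \<eta>_measurable[OF assms]]
    by eventually_elim (use \<eta>_nonneg[OF assms] \<eta>_le[OF assms] in \<open>fastforce simp: rate_def\<close>)
qed (use assms D_borel in auto)

lemma AE_transition:
  assumes "h \<in> {1..n}" "k \<in> {1..n}" "i \<in> {1..n}"
  shows "AE x in lebesgue_on (D h). AE y in lebesgue_on (D k). AE u in lebesgue_on (D i).
      transition h k i (x, y, u) = \<tau> h k i x y u"
    and "AE u in lebesgue_on (D i). AE x in lebesgue_on (D h). AE y in lebesgue_on (D k).
      transition h k i (x, y, u) = \<tau> h k i x y u"
proof -
  have ae: "AE (x, y, u) in lborel. x \<in> D h \<and> y \<in> D k \<and> u \<in> D i \<longrightarrow> transition h k i (x, y, u) = \<tau> h k i x y u"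
    using AE_borel_version[OF D_prod_lebesgue(2)[OF assms] \<tau>_measurable[OF assms]]
    by eventually_elim (use \<tau>_nonneg[OF assms] in \<open>fastforce simp: transition_def\<close>)
  note S = D_borel[OF assms(1)] D_borel[OF assms(2)] D_borel[OF assms(3)]
  show "AE x in lebesgue_on (D h). AE y in lebesgue_on (D k). AE u in lebesgue_on (D i).
      transition h k i (x, y, u) = \<tau> h k i x y u"
    by (rule AE_lborel_triple_sections(1)[OF ae S])
  show "AE u in lebesgue_on (D i). AE x in lebesgue_on (D h). AE y in lebesgue_on (D k).
      transition h k i (x, y, u) = \<tau> h k i x y u"
    by (rule AE_lborel_triple_sections(2)[OF ae S])
qed

lemma pair_rate_measurable: "pair_rate \<in> borel_measurable (M \<Otimes>\<^sub>M M)"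
proof -
  note [measurable] = fst_measurable_phase_space snd_measurable_phase_space
  have "(\<lambda>p. rate (fst (fst p)) (fst (snd p)) (snd (fst p), snd (snd p))) \<in> borel_measurable (M \<Otimes>\<^sub>M M)"
  proof (rule measurable_compose_countable'[where g = "\<lambda>p. fst (fst p)" and I = "{1..n}"])
    fix h assume h: "h \<in> {1..n}"
    show "(\<lambda>p. rate h (fst (snd p)) (snd (fst p), snd (snd p))) \<in> borel_measurable (M \<Otimes>\<^sub>M M)"
    proof (rule measurable_compose_countable'[where g = "\<lambda>p. fst (snd p)" and I = "{1..n}"])
      fix k assume k: "k \<in> {1..n}"
      show "(\<lambda>p. rate h k (snd (fst p), snd (snd p))) \<in> borel_measurable (M \<Otimes>\<^sub>M M)"
        by (rule measurable_compose[OF _ rate_borel[OF h k]]) (simp only: borel_prod[symmetric], measurable)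
    qed (rule measurable_compose[OF measurable_snd fst_measurable_phase_space] countable_finite finite_atLeastAtMost)+
  qed (rule measurable_compose[OF measurable_fst fst_measurable_phase_space] countable_finite finite_atLeastAtMost)+
  then show ?thesis by (simp add: pair_rate_def[abs_def])
qed

lemma pair_kernel_measurable: "case_prod pair_kernel \<in> borel_measurable ((M \<Otimes>\<^sub>M M) \<Otimes>\<^sub>M M)"
proof -
  note [measurable] = fst_measurable_phase_space snd_measurable_phase_space pair_rate_measurable
  let ?N = "(M \<Otimes>\<^sub>M M) \<Otimes>\<^sub>M M"
  have [measurable]: "(\<lambda>q. transition (fst (fst (fst q))) (fst (snd (fst q))) (fst (snd q))
      (snd (fst (fst q)), snd (snd (fst q)), snd (snd q))) \<in> borel_measurable ?N"
  proof (rule measurable_compose_countable'[where g = "\<lambda>q. fst (fst (fst q))" and I = "{1..n}"])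
    fix h assume h: "h \<in> {1..n}"
    show "(\<lambda>q. transition h (fst (snd (fst q))) (fst (snd q))
      (snd (fst (fst q)), snd (snd (fst q)), snd (snd q))) \<in> borel_measurable ?N"
    proof (rule measurable_compose_countable'[where g = "\<lambda>q. fst (snd (fst q))" and I = "{1..n}"])
      fix k assume k: "k \<in> {1..n}"
      show "(\<lambda>q. transition h k (fst (snd q))
        (snd (fst (fst q)), snd (snd (fst q)), snd (snd q))) \<in> borel_measurable ?N"
      proof (rule measurable_compose_countable'[where g = "\<lambda>q. fst (snd q)" and I = "{1..n}"])
        fix i assume i: "i \<in> {1..n}"
        show "(\<lambda>q. transition h k i (snd (fst (fst q)), snd (snd (fst q)), snd (snd q))) \<in> borel_measurable ?N"
          by (rule measurable_compose[OF _ transition_borel[OF h k i]]) (simp only: borel_prod[symmetric], measurable)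
      qed (rule measurable_compose[OF measurable_snd fst_measurable_phase_space]
          countable_finite finite_atLeastAtMost)+
    qed (rule measurable_compose[OF measurable_fst measurable_compose[OF measurable_snd fst_measurable_phase_space]]
        countable_finite finite_atLeastAtMost)+
  qed (rule measurable_compose[OF measurable_fst measurable_compose[OF measurable_fst fst_measurable_phase_space]]
      countable_finite finite_atLeastAtMost)+
  have "case_prod pair_kernel = (\<lambda>q. pair_rate (fst q) * transition (fst (fst (fst q))) (fst (snd (fst q))) (fst (snd q))
      (snd (fst (fst q)), snd (snd (fst q)), snd (snd q)))"
    by (auto simp: pair_kernel_def)
  also have "\<dots> \<in> borel_measurable ?N" by measurable
  finally show ?thesis .
qed

lemma pair_kernel_section:
  assumes hk: "h \<in> {1..n}" "k \<in> {1..n}" and xy: "x \<in> D h" "y \<in> D k"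
    and ae: "\<forall>i\<in>{1..n}. AE u in lebesgue_on (D i). transition h k i (x, y, u) = \<tau> h k i x y u"
  shows "integrable M (pair_kernel ((h, x), (k, y))) \<and> (LINT w|M. pair_kernel ((h, x), (k, y)) w) = pair_rate ((h, x), (k, y))"
proof
  let ?K = "pair_kernel ((h, x), (k, y))" and ?e = "rate h k (x, y)"
  have K: "?K (i, u) = ?e * transition h k i (x, y, u)" for i u by (simp add: pair_kernel_def pair_rate_def)
  have "set_integrable lebesgue (D i) (\<lambda>u. transition h k i (x, y, u))" if i: "i \<in> {1..n}" for i
  proof (rule set_integrable_lebesgue_cong_AE[OF D_borel[OF i]])
    show "set_integrable lebesgue (D i) (\<tau> h k i x y)" using \<tau>_integrable hk xy i by blast
    show "AE u in lebesgue_on (D i). \<tau> h k i x y u = transition h k i (x, y, u)"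
      using bspec[OF ae i] by eventually_elim simp
  qed
  then show int: "integrable M ?K"
    unfolding integrable_phase_space_iff K by (intro ballI set_integrable_mult_right) auto
  have "(LINT w|M. ?K w) = (\<Sum>i\<in>{1..n}. LINT u:D i|lebesgue. ?e * transition h k i (x, y, u))"
    using integral_phase_space[OF int] by (simp only: K)
  also have "\<dots> = ?e * (\<Sum>i\<in>{1..n}. LINT u:D i|lebesgue. transition h k i (x, y, u))"
    by (simp add: sum_distrib_left)
  also have "(\<Sum>i\<in>{1..n}. LINT u:D i|lebesgue. transition h k i (x, y, u))
      = (\<Sum>i\<in>{1..n}. LINT u:D i|lebesgue. \<tau> h k i x y u)"
    by (intro sum.cong refl set_integral_lebesgue_cong_AE D_borel) (use ae in auto)
  also have "\<dots> = 1" using \<tau>_normalized hk xy by blast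
  finally show "(LINT w|M. ?K w) = pair_rate ((h, x), (k, y))" by (simp add: pair_rate_def)
qed

lemma AE_pair_kernel_section: "AE p in M \<Otimes>\<^sub>M M. integrable M (pair_kernel p) \<and> (LINT w|M. pair_kernel p w) = pair_rate p"
proof -
  interpret MM: pair_sigma_finite M M ..
  note [measurable] = pair_kernel_measurable pair_rate_measurable
  show ?thesis
  proof (rule MM.AE_pair_measure)
    show "{p \<in> space (M \<Otimes>\<^sub>M M). integrable M (pair_kernel p) \<and> (LINT w|M. pair_kernel p w) = pair_rate p} \<in> sets (M \<Otimes>\<^sub>M M)"
      by measurable
    show "AE z in M. AE z' in M. integrable M (pair_kernel (z, z')) \<and> (LINT w|M. pair_kernel (z, z') w) = pair_rate (z, z')"
      unfolding AE_phase_space_iff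
    proof
      fix h assume h: "h \<in> {1..n}"
      have "AE x in lebesgue_on (D h). \<forall>k\<in>{1..n}. \<forall>i\<in>{1..n}. AE y in lebesgue_on (D k). AE u in lebesgue_on (D i).
         transition h k i (x, y, u) = \<tau> h k i x y u"
        by (intro AE_finite_allI AE_transition(1) h) auto
      with AE_space show "AE x in lebesgue_on (D h). \<forall>k\<in>{1..n}. AE y in lebesgue_on (D k).
          integrable M (pair_kernel ((h, x), (k, y))) \<and> (LINT w|M. pair_kernel ((h, x), (k, y)) w) = pair_rate ((h, x), (k, y))"
      proof eventually_elim
        case (elim x)
        show ?case
        proof
          fix k assume k: "k \<in> {1..n}"
          have "AE y in lebesgue_on (D k). \<forall>i\<in>{1..n}. AE u in lebesgue_on (D i).
             transition h k i (x, y, u) = \<tau> h k i x y u"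
            using elim k by (intro AE_finite_allI) auto
          with AE_space show "AE y in lebesgue_on (D k).
            integrable M (pair_kernel ((h, x), (k, y))) \<and> (LINT w|M. pair_kernel ((h, x), (k, y)) w) = pair_rate ((h, x), (k, y))"
          proof eventually_elim
            case (elim y)
            show ?case
              by (rule pair_kernel_section[OF h k _ _ elim(2)])
                (use elim(1) \<open>x \<in> space (lebesgue_on (D h))\<close> in \<open>simp_all add: space_restrict_space\<close>)
          qed
        qed
      qed
    qed
  qed
qed

sublocale interaction_kernel M pair_kernel pair_rate C
proof
  show "case_prod pair_kernel \<in> borel_measurable ((M \<Otimes>\<^sub>M M) \<Otimes>\<^sub>M M)" by (rule pair_kernel_measurable)
  show "pair_rate \<in> borel_measurable (M \<Otimes>\<^sub>M M)" by (rule pair_rate_measurable)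
  show "0 \<le> pair_kernel p w" for p w by (simp add: pair_kernel_def pair_rate_def rate_def transition_def)
  show "0 \<le> pair_rate p" "pair_rate p \<le> C" for p using C_pos by (auto simp: pair_rate_def rate_def)
  show "0 < C" by (rule C_pos)
  show "AE p in M \<Otimes>\<^sub>M M. integrable M (pair_kernel p) \<and> (LINT w|M. pair_kernel p w) = pair_rate p" by (rule AE_pair_kernel_section)
qed

text \<open>
  For almost every state \<open>(i, u)\<close>, Fubini's theorem applies to the gain integral, and the Borel versions of the rates agree
  with \<open>\<eta>\<close> and \<open>\<tau>\<close> for almost all partners; the iterated integrals then coincide with those of the kinetic equation.
\<close>
lemma AE_collision_rhs_eq_kinetic_rhs:
  assumes g: "integrable M (case_prod g)"
  shows "AE z in M. collision_rhs (case_prod g) z = case_prod (kinetic_rhs n D \<eta> \<tau> g) z"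
  unfolding AE_phase_space_iff
proof
  let ?f = "case_prod g"
  fix i assume i: "i \<in> {1..n}"
  have 1: "AE u in lebesgue_on (D i). integrable (M \<Otimes>\<^sub>M M) (\<lambda>p. pair_kernel p (i, u) * tensor ?f ?f p)"
    using AE_gain_section[OF tensor_integrable[OF g g]] i unfolding AE_phase_space_iff by blast
  have 2: "AE u in lebesgue_on (D i). \<forall>h\<in>{1..n}. \<forall>k\<in>{1..n}. AE x in lebesgue_on (D h). AE y in lebesgue_on (D k).
      transition h k i (x, y, u) = \<tau> h k i x y u"
    by (intro AE_finite_allI AE_transition(2) i) auto
  have 3: "AE u in lebesgue_on (D i). \<forall>k\<in>{1..n}. AE y in lebesgue_on (D k). rate i k (u, y) = \<eta> i k u y"
    by (intro AE_finite_allI AE_rate i) auto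
  show "AE u in lebesgue_on (D i). collision_rhs ?f (i, u) = case_prod (kinetic_rhs n D \<eta> \<tau> g) (i, u)"
    using 1 2 3 AE_space
  proof eventually_elim
    case (elim u)
    have w: "(i, u) \<in> space M" using elim(4) i by (simp add: space_phase_space space_restrict_space)
    have "gain (tensor ?f ?f) (i, u) = (\<Sum>h\<in>{1..n}. \<Sum>k\<in>{1..n}. LINT x:D h|lebesgue. LINT y:D k|lebesgue.
        pair_kernel ((h, x), (k, y)) (i, u) * tensor ?f ?f ((h, x), (k, y)))"
      unfolding gain_def by (rule integral_phase_space_pair[OF elim(1)])
    also have "\<dots> = (\<Sum>h\<in>{1..n}. \<Sum>k\<in>{1..n}. LINT x:D h|lebesgue. LINT y:D k|lebesgue.
        \<eta> h k x y * \<tau> h k i x y u * g h x * g k y)"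
    proof (intro sum.cong refl set_integral_lebesgue_cong_AE D_borel)
      fix h k assume h: "h \<in> {1..n}" and k: "k \<in> {1..n}"
      have "AE x in lebesgue_on (D h). AE y in lebesgue_on (D k). transition h k i (x, y, u) = \<tau> h k i x y u"
        using elim(2) h k by blast
      with AE_rate[OF h k] show "AE x in lebesgue_on (D h).
          (LINT y:D k|lebesgue. pair_kernel ((h, x), (k, y)) (i, u) * tensor ?f ?f ((h, x), (k, y)))
          = (LINT y:D k|lebesgue. \<eta> h k x y * \<tau> h k i x y u * g h x * g k y)"
      proof eventually_elim
        case (elim x)
        show ?case
        proof (rule set_integral_lebesgue_cong_AE[OF D_borel[OF k]])
          show "AE y in lebesgue_on (D k). pair_kernel ((h, x), (k, y)) (i, u) * tensor ?f ?f ((h, x), (k, y))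
              = \<eta> h k x y * \<tau> h k i x y u * g h x * g k y"
            using elim by eventually_elim (simp add: pair_kernel_def pair_rate_def tensor_def)
        qed
      qed
    qed
    finally have gain: "gain (tensor ?f ?f) (i, u) = (\<Sum>h\<in>{1..n}. \<Sum>k\<in>{1..n}. LINT x:D h|lebesgue. LINT y:D k|lebesgue.
        \<eta> h k x y * \<tau> h k i x y u * g h x * g k y)" .
    have "(LINT z|M. pair_rate ((i, u), z) * ?f z) = (\<Sum>k\<in>{1..n}. LINT y:D k|lebesgue. pair_rate ((i, u), (k, y)) * ?f (k, y))"
      by (rule integral_phase_space[OF rate_section_integrable[OF g w]])
    also have "\<dots> = (\<Sum>k\<in>{1..n}. LINT x:D k|lebesgue. \<eta> i k u x * g k x)"
    proof (intro sum.cong refl set_integral_lebesgue_cong_AE D_borel)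
      fix k assume "k \<in> {1..n}"
      then have "AE y in lebesgue_on (D k). rate i k (u, y) = \<eta> i k u y" using elim(3) by blast
      then show "AE y in lebesgue_on (D k). pair_rate ((i, u), (k, y)) * ?f (k, y) = \<eta> i k u y * g k y"
        by eventually_elim (simp add: pair_rate_def)
    qed
    finally have loss: "(LINT z|M. pair_rate ((i, u), z) * ?f z) = (\<Sum>k\<in>{1..n}. LINT x:D k|lebesgue. \<eta> i k u x * g k x)" .
    show ?case
      unfolding collision_rhs_eq[OF g w] gain loss kinetic_rhs_def by simp
  qed
qed

lemma kinetic_rhs_integrable:
  assumes "integrable M (case_prod g)"
  shows "integrable M (case_prod (kinetic_rhs n D \<eta> \<tau> g))"
  using collision_rhs_integrable[OF assms] AE_collision_rhs_eq_kinetic_rhs[OF assms]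
  by (rule integrable_phase_space_cong_AE)

lemma X_has_derivative_on_kinetic_rhs_iff:
  "X_has_derivative_on n D I f (\<lambda>t. kinetic_rhs n D \<eta> \<tau> (f t)) \<longleftrightarrow>
     L1_has_derivative_on M I (\<lambda>t. case_prod (f t)) (\<lambda>t. collision_rhs (case_prod (f t)))"
proof (cases "\<forall>t\<in>I. integrable M (case_prod (f t))")
  case True
  show ?thesis
    unfolding X_has_derivative_on_iff
  proof (rule L1_has_derivative_on_cong_AE)
    fix t assume "t \<in> I"
    then show f: "integrable M (case_prod (f t))" using True by blast
    show "integrable M (case_prod (kinetic_rhs n D \<eta> \<tau> (f t)))" by (rule kinetic_rhs_integrable[OF f])
    show "integrable M (collision_rhs (case_prod (f t)))" by (rule collision_rhs_integrable[OF f])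
    show "AE z in M. case_prod (kinetic_rhs n D \<eta> \<tau> (f t)) z = collision_rhs (case_prod (f t)) z"
      using AE_collision_rhs_eq_kinetic_rhs[OF f] by eventually_elim simp
  qed
next
  case False
  then show ?thesis unfolding X_has_derivative_on_iff L1_has_derivative_on_def by auto
qed

lemma X_continuous_on_kinetic_rhs:
  assumes d: "L1_has_derivative_on M I (\<lambda>t. case_prod (f t)) f'"
  shows "X_continuous_on n D I (\<lambda>t. kinetic_rhs n D \<eta> \<tau> (f t))"
  unfolding X_continuous_on_def
proof (intro conjI ballI)
  fix t assume t: "t \<in> I"
  have int: "integrable M (case_prod (f s))" if "s \<in> I" for s
    using d that by (auto simp: L1_has_derivative_on_def)
  show "kinetic_rhs n D \<eta> \<tau> (f t) \<in> X_space n D"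
    unfolding X_space_iff_integrable by (rule kinetic_rhs_integrable[OF int[OF t]])
  show "((\<lambda>s. X_norm n D (\<lambda>i u. kinetic_rhs n D \<eta> \<tau> (f s) i u - kinetic_rhs n D \<eta> \<tau> (f t) i u)) \<longlongrightarrow> 0) (at t within I)"
  proof (rule Lim_transform_eventually[OF collision_rhs_continuous[OF d t]])
    show "\<forall>\<^sub>F s in at t within I.
        L1_norm M (\<lambda>w. collision_rhs (case_prod (f s)) w - collision_rhs (case_prod (f t)) w)
        = X_norm n D (\<lambda>i u. kinetic_rhs n D \<eta> \<tau> (f s) i u - kinetic_rhs n D \<eta> \<tau> (f t) i u)"
      unfolding eventually_at_filter
    proof (intro always_eventually allI impI)
      fix s assume s: "s \<in> I"
      let ?k = "\<lambda>s. case_prod (kinetic_rhs n D \<eta> \<tau> (f s))"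
      have eq: "case_prod (\<lambda>i u. kinetic_rhs n D \<eta> \<tau> (f s) i u - kinetic_rhs n D \<eta> \<tau> (f t) i u)
         = (\<lambda>z. ?k s z - ?k t z)" by auto
      have ik: "integrable M (\<lambda>z. ?k s z - ?k t z)"
        by (intro Bochner_Integration.integrable_diff kinetic_rhs_integrable int s t)
      have "L1_norm M (\<lambda>w. collision_rhs (case_prod (f s)) w - collision_rhs (case_prod (f t)) w)
          = L1_norm M (\<lambda>z. ?k s z - ?k t z)"
      proof (rule L1_norm_cong_AE[OF _ ik])
        show "integrable M (\<lambda>w. collision_rhs (case_prod (f s)) w - collision_rhs (case_prod (f t)) w)"
          by (intro Bochner_Integration.integrable_diff collision_rhs_integrable int s t)
        show "AE w in M. collision_rhs (case_prod (f s)) w - collision_rhs (case_prod (f t)) w = ?k s w - ?k t w"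
          using AE_collision_rhs_eq_kinetic_rhs[OF int[OF s]] AE_collision_rhs_eq_kinetic_rhs[OF int[OF t]]
          by eventually_elim simp
      qed
      also have "\<dots> = X_norm n D (\<lambda>i u. kinetic_rhs n D \<eta> \<tau> (f s) i u - kinetic_rhs n D \<eta> \<tau> (f t) i u)"
        using X_norm_eq_L1_norm[of "\<lambda>i u. kinetic_rhs n D \<eta> \<tau> (f s) i u - kinetic_rhs n D \<eta> \<tau> (f t) i u"] ik
        by (simp only: eq)
      finally show "L1_norm M (\<lambda>w. collision_rhs (case_prod (f s)) w - collision_rhs (case_prod (f t)) w)
        = X_norm n D (\<lambda>i u. kinetic_rhs n D \<eta> \<tau> (f s) i u - kinetic_rhs n D \<eta> \<tau> (f t) i u)" .
    qed
  qed
qed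

text \<open>
  For a curve that satisfies the equation, membership in \<open>C1_space\<close> is automatic: its derivative is the right hand side,
  which is continuous along the curve.
\<close>
lemma kinetic_solution_iff:
  "kinetic_solution n D \<eta> \<tau> f0 I f \<longleftrightarrow>
     L1_has_derivative_on M I (\<lambda>t. case_prod (f t)) (\<lambda>t. collision_rhs (case_prod (f t))) \<and>
     X_eq n D (f 0) f0"
  unfolding kinetic_solution_def C1_space_def X_has_derivative_on_kinetic_rhs_iff
  using X_continuous_on_kinetic_rhs X_has_derivative_on_kinetic_rhs_iff by blast

end

section \<open>Well-posedness\<close>

theorem theorem1:
  fixes T :: ereal
    and n :: nat
    and D :: "nat \<Rightarrow> real set"
    and \<eta> :: "nat \<Rightarrow> nat \<Rightarrow> real \<Rightarrow> real \<Rightarrow> real"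
    and \<tau> :: "nat \<Rightarrow> nat \<Rightarrow> nat \<Rightarrow> real \<Rightarrow> real \<Rightarrow> real \<Rightarrow> real"
    and f0 :: "nat \<Rightarrow> real \<Rightarrow> real"
  assumes T_pos: "0 < T"
    and n_pos: "1 \<le> n"
    and D_interval: "\<And>i. i \<in> {1..n} \<Longrightarrow> is_interval (D i)"
    and D_nonneg: "\<And>i. i \<in> {1..n} \<Longrightarrow> D i \<subseteq> {0..}"
    and eta_measurable: "\<And>h k. h \<in> {1..n} \<Longrightarrow> k \<in> {1..n} \<Longrightarrow>
          (\<lambda>(x, y). \<eta> h k x y) \<in> borel_measurable (lebesgue_on (D h \<times> D k))"
    and eta_pos: "\<And>h k x y. h \<in> {1..n} \<Longrightarrow> k \<in> {1..n} \<Longrightarrow> x \<in> D h \<Longrightarrow> y \<in> D k \<Longrightarrow>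
          0 < \<eta> h k x y"
    and tau_measurable: "\<And>h k i. h \<in> {1..n} \<Longrightarrow> k \<in> {1..n} \<Longrightarrow> i \<in> {1..n} \<Longrightarrow>
          (\<lambda>(x, y, u). \<tau> h k i x y u) \<in> borel_measurable (lebesgue_on (D h \<times> D k \<times> D i))"
    and tau_pos: "\<And>h k i x y u. h \<in> {1..n} \<Longrightarrow> k \<in> {1..n} \<Longrightarrow> i \<in> {1..n} \<Longrightarrow>
          x \<in> D h \<Longrightarrow> y \<in> D k \<Longrightarrow> u \<in> D i \<Longrightarrow> 0 < \<tau> h k i x y u"
    and tau_integrable: "\<And>h k i x y. h \<in> {1..n} \<Longrightarrow> k \<in> {1..n} \<Longrightarrow> i \<in> {1..n} \<Longrightarrow>
          x \<in> D h \<Longrightarrow> y \<in> D k \<Longrightarrow> \<tau> h k i x y absolutely_integrable_on D i"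
    and tau_normalized: "\<And>h k x y. h \<in> {1..n} \<Longrightarrow> k \<in> {1..n} \<Longrightarrow> x \<in> D h \<Longrightarrow> y \<in> D k \<Longrightarrow>
          (\<Sum>i\<in>{1..n}. LINT u:D i|lebesgue. \<tau> h k i x y u) = 1"
    and f0_in_X: "f0 \<in> X_space n D"
    and f0_nonneg: "\<And>i. i \<in> {1..n} \<Longrightarrow> AE u in lebesgue_on (D i). 0 \<le> f0 i u"
    and f0_normalized: "(\<Sum>i\<in>{1..n}. LINT u:D i|lebesgue. f0 i u) = 1"
    and eta_bounded: "\<exists>C\<ge>0. \<forall>h\<in>{1..n}. \<forall>k\<in>{1..n}. \<forall>x\<in>D h. \<forall>y\<in>D k. \<eta> h k x y < C"
  shows "\<exists>f. kinetic_solution n D \<eta> \<tau> f0 (time_interval T) f \<and>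
           (\<forall>g. kinetic_solution n D \<eta> \<tau> f0 (time_interval T) g \<longrightarrow>
              (\<forall>t\<in>time_interval T. X_eq n D (g t) (f t)))"
proof -
  let ?I = "time_interval T" and ?F0 = "case_prod f0"
  obtain C0 where C0: "0 \<le> C0"
    "\<And>h k x y. h \<in> {1..n} \<Longrightarrow> k \<in> {1..n} \<Longrightarrow> x \<in> D h \<Longrightarrow> y \<in> D k \<Longrightarrow> \<eta> h k x y < C0"
    using eta_bounded by blast
  \<comment> \<open>The recursion for the Wild terms divides by the bound on the rates, which therefore has to be positive.\<close>
  interpret kinetic_system n D \<eta> \<tau> "C0 + 1"
  proof
    fix h k i x y
    assume hk: "h \<in> {1..n}" "k \<in> {1..n}"
    show "(\<lambda>(x, y). \<eta> h k x y) \<in> borel_measurable (lebesgue_on (D h \<times> D k))"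
      using hk by (rule eta_measurable)
    assume i: "i \<in> {1..n}"
    show "(\<lambda>(x, y, u). \<tau> h k i x y u) \<in> borel_measurable (lebesgue_on (D h \<times> D k \<times> D i))"
      using hk i by (rule tau_measurable)
  next
    fix h k x y assume *: "h \<in> {1..n}" "k \<in> {1..n}" "x \<in> D h" "y \<in> D k"
    show "0 \<le> \<eta> h k x y" using eta_pos[OF *] by simp
    show "\<eta> h k x y \<le> C0 + 1" using C0(2)[OF *] by simp
    show "(\<Sum>i\<in>{1..n}. LINT u:D i|lebesgue. \<tau> h k i x y u) = 1" using * by (rule tau_normalized)
    fix i assume i: "i \<in> {1..n}"
    show "\<tau> h k i x y absolutely_integrable_on D i" using *(1,2) i *(3,4) by (rule tau_integrable)
    fix u assume "u \<in> D i"
    with tau_pos[OF *(1,2) i *(3,4)] show "0 \<le> \<tau> h k i x y u" by (simp add: less_imp_le)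
  qed (use C0(1) D_interval real_interval_borel_measurable in auto)
  have F0: "integrable M ?F0" using f0_in_X by (simp only: X_space_iff_integrable)
  have mass: "(LINT z|M. ?F0 z) = 1" using integral_phase_space[OF F0] f0_normalized by simp
  have norm: "L1_norm M ?F0 \<le> 1"
  proof -
    have "AE z in M. 0 \<le> ?F0 z" unfolding AE_phase_space_iff using f0_nonneg by simp
    then have "L1_norm M ?F0 = (LINT z|M. ?F0 z)"
      unfolding L1_norm_def using F0 by (intro integral_cong_AE) (auto elim!: eventually_mono)
    then show ?thesis using mass by simp
  qed
  define f where "f t i u = wild_sum ?F0 t (i, u)" for t i u
  have f: "case_prod (f t) = wild_sum ?F0 t" for t by (auto simp: f_def)
  have I_sub: "?I \<subseteq> {0..}" by (auto simp: time_interval_def)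
  have 0: "0 \<in> ?I" using T_pos by (simp add: time_interval_def zero_ereal_def[symmetric] less_imp_le)
  have Icc_sub: "{0..t} \<subseteq> ?I" if "t \<in> ?I" for t
    using that by (auto simp: time_interval_def intro: order_trans[of "ereal _" "ereal t"])
  have df: "L1_has_derivative_on M ?I (\<lambda>t. case_prod (f t)) (\<lambda>t. collision_rhs (case_prod (f t)))"
    unfolding f by (rule L1_has_derivative_on_subset[OF wild_sum_solution(1)[OF F0 norm mass] I_sub])
  have f0: "X_eq n D (f 0) f0"
    unfolding X_eq_iff_AE f wild_sum_solution(2)[OF F0 norm mass] by simp
  show ?thesis
  proof (intro exI conjI allI impI ballI)
    show "kinetic_solution n D \<eta> \<tau> f0 ?I f" unfolding kinetic_solution_iff using df f0 by blast
    fix g t assume g: "kinetic_solution n D \<eta> \<tau> f0 ?I g" and t: "t \<in> ?I"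
    have dg: "L1_has_derivative_on M ?I (\<lambda>t. case_prod (g t)) (\<lambda>t. collision_rhs (case_prod (g t)))"
      and g0: "X_eq n D (g 0) f0"
      using g unfolding kinetic_solution_iff by auto
    have "AE z in M. case_prod (g 0) z = case_prod (f 0) z"
      using f0 g0 unfolding X_eq_iff_AE by eventually_elim simp
    moreover have "0 \<le> t" using t I_sub by auto
    ultimately show "X_eq n D (g t) (f t)"
      unfolding X_eq_iff_AE
      by (intro collision_solution_unique[of t "\<lambda>t. case_prod (g t)" "\<lambda>t. case_prod (f t)"]
          L1_has_derivative_on_subset[OF dg Icc_sub[OF t]] L1_has_derivative_on_subset[OF df Icc_sub[OF t]])
  qed
qed

end
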